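(* Let $q_1\in\mathbb{C}^{2n}$ be such that none of the $\Pi^-$-leading principal minors of $K_{2k+2}(\mathscr{H},q_1)^H\,\Gamma_0\,K_{2k+2}(\mathscr{H},q_1)$ vanishes. Let $K_{2k+2}(\mathscr{H},q_1)=Q_{2k+2}R_{2k+2}$ be a (skinny) $\Gamma$QR factorization with respect to $\Gamma_0$, so that $Q_{2k+2}^H\Gamma_0Q_{2k+2}=\Gamma_{2k+2}$ for some $\Gamma_{2k+2}\in\mathbf{\Gamma}_{2k+2}$. Write $$R_{2k+2}=\begin{bmatrix}R_t&r_t&\overline{R}_s&\overline{r}_s\\0&\tau_{k+1}&0&0\\ R_s&r_s&\overline{R}_t&\overline{r}_t\\0&0&0&\overline{\tau}_{k+1}\end{bmatrix},\qquad R_{2k}=\begin{bmatrix}R_t&\overline{R}_s\\ R_s&\overline{R}_t\end{bmatrix},$$ $$Q_{2k+2}=\begin{bmatrix}U_k&u_{k+1}&\Pi\overline{U}_k&\Pi\overline{u}_{k+1}\end{bmatrix},\qquad Q_{2k}=\begin{bmatrix}U_k&\Pi\overline{U}_k\end{bmatrix},$$ $$\Gamma_{2k+2}=\mathrm{diag}(D_k,\delta_{k+1},-D_k,-\delta_{k+1}),\qquad \Gamma_{2k}=\mathrm{diag}(D_k,-D_k),$$ where $R_t,R_s\in\mathbb{C}^{k\times k}$ are upper triangular and strictly upper triangular respectively, $r_t,r_s\in\mathbb{C}^k$, $\tau_{k+1}\in\mathbb{C}$, $U_k\in\mathbb{C}^{2n\times k}$, $u_{k+1}\in\mathbb{C}^{2n}$,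 $D_k\in\mathbb{C}^{k\times k}$, $\delta_{k+1}\in\mathbb{C}$. Denote by $\zeta_{kk}$ the $(k,k)$ entry of $R_{2k}^{-1}$. Then: (i) $R_{2k}$ is nonsingular and $$R_{2k}^{-1}=\begin{bmatrix}(R_t-\overline{R}_s\overline{R}_t^{-1}R_s)^{-1}&-(R_t-\overline{R}_s\overline{R}_t^{-1}R_s)^{-1}\overline{R}_s\overline{R}_t^{-1}\\-(\overline{R}_t-R_sR_t^{-1}\overline{R}_s)^{-1}R_sR_t^{-1}&(\overline{R}_t-R_sR_t^{-1}\overline{R}_s)^{-1}\end{bmatrix},$$ whose $(1,1)$ and $(1,2)$ blocks are upper triangular and strictly upper triangular, respectively; (ii) $K_{2k}(\mathscr{H},q_1)=Q_{2k}R_{2k}$; (iii) $Q_{2k}^H\Gamma_0Q_{2k}=\Gamma_{2k}$; (iv) $\mathscr{H}Q_{2k}=Q_{2k+2}\widetilde{T}_{2k}$ and $Q_{2k}^H\Gamma_0\mathscr{H}Q_{2k}=\Gamma_{2k}\begin{bmatrix}T_{11}&-\overline{T}_{21}\\ T_{21}&-\overline{T}_{11}\end{bmatrix}$, where $$\widetilde{T}_{2k}=\begin{bmatrix}T_{11}&-\overline{T}_{21}\\ \zeta_{kk}\tau_{k+1}e_k^T&0\\ T_{21}&-\overline{T}_{11}\\0&-\overline{\zeta}_{kk}\overline{\tau}_{k+1}e_k^T\end{bmatrix}\in\mathbb{C}^{(2k+2)\times 2k}$$ with $T_{11}\in\mathbb{C}^{k\times k}$ unreduced tridiagonal and $T_{21}\in\mathbb{C}^{k\times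 k}$ diagonal; (v) $(D_kT_{11})^H=D_kT_{11}$ for the matrix $T_{11}$ of (iv); (vi) $Q_{2k}^H\Gamma_0u_{k+1}=0$ and $Q_{2k}^H\Gamma_0\Pi\overline{u}_{k+1}=0$.
   Context: $\mathscr{H}=\begin{bmatrix}A&B\\-\overline{B}&-\overline{A}\end{bmatrix}\in\mathbb{C}^{2n\times 2n}$, where $A,B\in\mathbb{C}^{n\times n}$ satisfy $A^H=A$, $B^T=B$. For a positive integer $m$, $\Pi_{2m}=\begin{bmatrix}0&I_m\\ I_m&0\end{bmatrix}$ and $\Pi=\Pi_{2n}$; $\Gamma_0=\mathrm{diag}(I_n,-I_n)$; $\mathbf{\Gamma}_{2m}=\{\mathrm{diag}(J,-J): J$ an $m\times m$ diagonal matrix with diagonal entries $\pm1\}$. $e_k$ is the $k$-th column of the identity. $\Pi^\pm$-matrices: $G\in\mathbb{C}^{2n\times 2m}$ ($m\le n$) is a $\Pi^\pm$-matrix if $G\Pi_{2m}=\pm\Pi_{2n}\overline{G}$, i.e. $G=\begin{bmatrix}G_1&G_2\\ \pm\overline{G}_2&\pm\overline{G}_1\end{bmatrix}$ with $G_1,G_2\in\mathbb{C}^{n\times m}$. For a square $\Pi^\pm$-matrix $G$, its $i$-th $\Pi^\pm$-leading principal minor is $\det\begin{bmatrix}G_{1i}&G_{2i}\\ \pm\overline{G}_{2i}&\pm\overline{G}_{1i}\end{bmatrix}$ with $G_{1i}=G_1(1:i,1:i)$, $G_{2i}=G_2(1:i,1:i)$. A $\Pi^\pm$-matrix is $\Pi^\pm$-upper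 triangular if $G_1$ is upper triangular and $G_2$ is strictly upper triangular. A (skinny) $\Gamma$QR factorization of a $\Pi^+$-matrix $G\in\mathbb{C}^{2n\times 2m}$ with respect to $\Gamma_0$ is $G=QR$ with $R\in\mathbb{C}^{2m\times 2m}$ a $\Pi^+$-upper triangular matrix and $Q\in\mathbb{C}^{2n\times 2m}$ a $\Pi^+$-matrix satisfying $Q^H\Gamma_0Q\in\mathbf{\Gamma}_{2m}$. The $k$-th order $\mathbf{\Pi}$-Krylov matrix is $$K_{2k}(\mathscr{H},q_1)=\begin{bmatrix}q_1&\mathscr{H}q_1&\cdots&\mathscr{H}^{k-1}q_1&\Pi\overline{q}_1&\Pi\overline{\mathscr{H}}\,\overline{q}_1&\cdots&\Pi\overline{\mathscr{H}}^{k-1}\overline{q}_1\end{bmatrix}\in\mathbb{C}^{2n\times 2k},$$ and $K_{2k+2}(\mathscr{H},q_1)$ is the $(k+1)$-th order one; it is a $\Pi^+$-matrix, and $K_{2k+2}^H\Gamma_0K_{2k+2}$ is a $\Pi^-$-matrix. A tridiagonal matrix is unreduced if all its sub-diagonal entries are nonzero. *)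

theory Defs
  imports "Jordan_Normal_Form.Schur_Decomposition" "Jordan_Normal_Form.Gauss_Jordan_Elimination"
begin

text \<open>Indices are 0-based throughout: the mathematical entry \<open>(i, j)\<close> is \<open>$$ (i - 1, j - 1)\<close>.\<close>

abbreviation conj_mat :: "complex mat \<Rightarrow> complex mat" where
  "conj_mat M \<equiv> map_mat cnj M"

abbreviation conj_vec :: "complex vec \<Rightarrow> complex vec" where
  "conj_vec v \<equiv> map_vec cnj v"

abbreviation scalar_mat :: "complex \<Rightarrow> complex mat" where
  "scalar_mat c \<equiv> mat 1 1 (\<lambda>_. c)"

text \<open>\<open>the\<close> is only meaningful for invertible arguments; for singular ones the value is unspecified.\<close>

abbreviation inv_mat :: "complex mat \<Rightarrow> complex mat" where
  "inv_mat M \<equiv> the (mat_inverse M)"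

definition strictly_upper_triangular :: "complex mat \<Rightarrow> bool" where
  "strictly_upper_triangular M \<longleftrightarrow> (\<forall>i<dim_row M. \<forall>j<dim_col M. j \<le> i \<longrightarrow> M $$ (i, j) = 0)"

definition tridiagonal_mat :: "complex mat \<Rightarrow> bool" where
  "tridiagonal_mat M \<longleftrightarrow>
     (\<forall>i<dim_row M. \<forall>j<dim_col M. (j + 1 < i \<or> i + 1 < j) \<longrightarrow> M $$ (i, j) = 0)"

definition unreduced_tridiagonal_mat :: "complex mat \<Rightarrow> bool" where
  "unreduced_tridiagonal_mat M \<longleftrightarrow>
     tridiagonal_mat M \<and> (\<forall>i. i + 1 < dim_row M \<longrightarrow> M $$ (i + 1, i) \<noteq> 0)"

text \<open>The matrix \<open>\<Pi>\<close> of size \<open>2m\<close>.\<close>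

definition Pi_mat :: "nat \<Rightarrow> complex mat" where
  "Pi_mat m = four_block_mat (0\<^sub>m m m) (1\<^sub>m m) (1\<^sub>m m) (0\<^sub>m m m)"

definition Gamma0 :: "nat \<Rightarrow> complex mat" where
  "Gamma0 n = four_block_mat (1\<^sub>m n) (0\<^sub>m n n) (0\<^sub>m n n) (- 1\<^sub>m n)"

text \<open>The set of signature matrices \<open>diag(J, -J)\<close> of size \<open>2m\<close>.\<close>

definition Gamma_set :: "nat \<Rightarrow> complex mat set" where
  "Gamma_set m = {four_block_mat J (0\<^sub>m m m) (0\<^sub>m m m) (- J) | J.
     J \<in> carrier_mat m m \<and> diagonal_mat J \<and> (\<forall>i<m. J $$ (i, i) = 1 \<or> J $$ (i, i) = - 1)}"

text \<open>The sign \<open>s\<close> is \<open>1\<close> for \<open>\<Pi>\<^sup>+\<close> and \<open>-1\<close> for \<open>\<Pi>\<^sup>-\<close>; the matrix is \<open>2n \<times> 2m\<close>.\<close>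

definition is_Pi_mat :: "complex \<Rightarrow> nat \<Rightarrow> nat \<Rightarrow> complex mat \<Rightarrow> bool" where
  "is_Pi_mat s n m G \<longleftrightarrow> m \<le> n \<and> G \<in> carrier_mat (2 * n) (2 * m) \<and>
     G * Pi_mat m = s \<cdot>\<^sub>m (Pi_mat n * conj_mat G)"

text \<open>For a square \<open>2m \<times> 2m\<close> matrix \<open>G\<close> with upper blocks \<open>G\<^sub>1, G\<^sub>2\<close>: the \<open>i\<close>-th leading
  principal minor uses the leading \<open>i \<times> i\<close> parts of \<open>G\<^sub>1\<close> and \<open>G\<^sub>2\<close>.\<close>

definition Pi_leading_minor :: "complex \<Rightarrow> nat \<Rightarrow> complex mat \<Rightarrow> nat \<Rightarrow> complex" where
  "Pi_leading_minor s m G i =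
     (let G1 = mat i i (\<lambda>(a, b). G $$ (a, b));
          G2 = mat i i (\<lambda>(a, b). G $$ (a, m + b))
      in det (four_block_mat G1 G2 (s \<cdot>\<^sub>m conj_mat G2) (s \<cdot>\<^sub>m conj_mat G1)))"

definition Pi_upper_triangular :: "complex \<Rightarrow> nat \<Rightarrow> complex mat \<Rightarrow> bool" where
  "Pi_upper_triangular s m G \<longleftrightarrow> is_Pi_mat s m m G \<and>
     upper_triangular (mat m m (\<lambda>(a, b). G $$ (a, b))) \<and>
     strictly_upper_triangular (mat m m (\<lambda>(a, b). G $$ (a, m + b)))"

text \<open>Skinny \<open>\<Gamma>QR\<close> factorization of a \<open>2n \<times> 2m\<close> matrix with respect to \<open>Gamma0 n\<close>.
  That \<open>G\<close> is itself a \<open>\<Pi>\<^sup>+\<close>-matrix follows from \<open>G = Q * R\<close>.\<close>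

definition is_Gamma_QR :: "nat \<Rightarrow> nat \<Rightarrow> complex mat \<Rightarrow> complex mat \<Rightarrow> complex mat \<Rightarrow> bool" where
  "is_Gamma_QR n m G Q R \<longleftrightarrow> G = Q * R \<and>
     Pi_upper_triangular 1 m R \<and> is_Pi_mat 1 n m Q \<and>
     mat_adjoint Q * Gamma0 n * Q \<in> Gamma_set m"

text \<open>The \<open>k\<close>-th order \<open>\<Pi>\<close>-Krylov matrix, of size \<open>2n \<times> 2k\<close>.\<close>

definition Pi_Krylov :: "nat \<Rightarrow> nat \<Rightarrow> complex mat \<Rightarrow> complex vec \<Rightarrow> complex mat" where
  "Pi_Krylov n k H q = mat_of_cols (2 * n)
     (map (\<lambda>j. (H ^\<^sub>m j) *\<^sub>v q) [0..<k] @
      map (\<lambda>j. Pi_mat n *\<^sub>v ((conj_mat H ^\<^sub>m j) *\<^sub>v conj_vec q)) [0..<k])"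

end

theory Submission
  imports Defs
begin

text \<open>The theorem is the Arnoldi--Lanczos argument carried out inside the algebra of
  \<open>\<Pi>\<close>-symmetric matrices, which are determined by their first block column (\<open>Pi_block\<close>,
  \<open>Pi_block_mult\<close>).

  The last leading minor is the determinant of \<open>R\<^sup>H G R\<close>, so \<open>R\<close> is nonsingular. Up to
  interleaving the two halves of its indices, \<open>R\<close> is upper triangular with the diagonal entries
  of its upper left block and their conjugates on the diagonal, so none of these vanishes
  (\<open>Pi_upper_triangular_diag_nonzero\<close>). The leading part \<open>R2k\<close> then has the stated inverse, whose
  blocks are triangular because the Schur complement differs from \<open>Rt\<close> only above the first
  superdiagonal (\<open>Pi_block_inverse\<close>). The factorization of the smaller Krylov matrix, the Gram
  matrix of \<open>Q2k\<close> and the orthogonality of \<open>u\<close> are obtained by selecting columns.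

  On Krylov matrices \<open>H\<close> is a shift, with a sign in the second half
  (\<open>Hamiltonian_Krylov\<close>). Expressed in the columns of \<open>Q\<close>, it has as coefficients \<open>R\<close> times the
  shift times the inverse of \<open>R2k\<close>. Counting bands in this product gives a Hessenberg upper block
  \<open>T11\<close> with nonzero subdiagonal and an upper triangular lower block \<open>T21\<close>
  (\<open>Hessenberg_product\<close>). Finally \<open>\<Gamma>\<^sub>0 H\<close> is Hermitian, hence so is its compression to the columns
  of \<open>Q2k\<close>, whose blocks are \<open>D * T11\<close> and \<open>- (D * T21)\<close>: the first is
  Hermitian and the second symmetric. Since \<open>D\<close> is a diagonal signature matrix, the Hessenberg
  matrix is tridiagonal and the triangular one diagonal.\<close>

section \<open>Conjugates, adjoints and inverses\<close>

lemma conj_mat_mult: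
  "A \<in> carrier_mat a b \<Longrightarrow> B \<in> carrier_mat b c \<Longrightarrow> conj_mat (A * B) = conj_mat A * conj_mat B"
  by (rule eq_matI) (auto simp: scalar_prod_def)

lemma conj_mat_conj [simp]: "conj_mat (conj_mat A) = A"
  by (rule eq_matI) auto

lemma conj_mat_uminus: "conj_mat (- A) = - conj_mat A"
  by (rule eq_matI) auto

lemma conj_mat_one [simp]: "conj_mat (1\<^sub>m n) = 1\<^sub>m n"
  by (rule eq_matI) auto

lemma conj_mat_zero [simp]: "conj_mat (0\<^sub>m a b) = 0\<^sub>m a b"
  by (rule eq_matI) auto

lemma one_smult_mat [simp]: "1 \<cdot>\<^sub>m A = A" for A :: "complex mat"
  by (rule eq_matI) auto

lemma mat_adjoint_eq: "mat_adjoint A = transpose_mat (conj_mat A)" for A :: "complex mat"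
  by (rule eq_matI) (auto simp: mat_adjoint_def mat_of_rows_index)

lemma mat_adjoint_carrier [simp]:
  "A \<in> carrier_mat a b \<Longrightarrow> mat_adjoint A \<in> carrier_mat b a" for A :: "complex mat"
  by (simp add: mat_adjoint_eq)

lemma mat_adjoint_index:
  "i < dim_col A \<Longrightarrow> j < dim_row A \<Longrightarrow> mat_adjoint A $$ (i, j) = cnj (A $$ (j, i))"
  by (simp add: mat_adjoint_eq)

lemma mat_adjoint_mult:
  "A \<in> carrier_mat a b \<Longrightarrow> B \<in> carrier_mat b c \<Longrightarrow>
    mat_adjoint (A * B) = mat_adjoint B * mat_adjoint A" for A B :: "complex mat"
  by (simp add: mat_adjoint_eq conj_mat_mult[of A a b B c] transpose_mult[of _ a b _ c])

lemma mat_adjoint_adjoint [simp]: "mat_adjoint (mat_adjoint A) = A" for A :: "complex mat"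
  by (rule eq_matI) (auto simp: mat_adjoint_eq)

text \<open>A left inverse of a square matrix identifies the value of \<open>inv_mat\<close>, so
  closed formulas for inverses only have to be multiplied out on one side.\<close>

lemma inv_mat_unique:
  assumes A: "A \<in> carrier_mat n n" and X: "X \<in> carrier_mat n n" and XA: "X * A = 1\<^sub>m n"
  shows "invertible_mat A" and "inv_mat A = X"
proof -
  have AX: "A * X = 1\<^sub>m n" using mat_mult_left_right_inverse[OF X A XA] .
  show "invertible_mat A" unfolding invertible_mat_def inverts_mat_def using A X XA AX by auto
  have "A \<in> Units (ring_mat TYPE(complex) n ())"
    unfolding Units_def using A X XA AX by (auto simp: ring_mat_simps)
  then obtain Y where Y: "mat_inverse A = Some Y"
    using mat_inverse(1)[OF A, where b = "()"] by (cases "mat_inverse A") auto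
  from mat_inverse(2)[OF A Y] have Y': "A * Y = 1\<^sub>m n" "Y \<in> carrier_mat n n" by auto
  have "X = X * (A * Y)" using Y' X by simp
  also have "\<dots> = (X * A) * Y" using assoc_mult_mat[OF X A Y'(2)] by simp
  also have "\<dots> = Y" using XA Y' by simp
  finally show "inv_mat A = X" using Y by simp
qed

lemma inv_mat_det:
  assumes A: "A \<in> carrier_mat n n" and d: "det A \<noteq> 0"
  shows "invertible_mat A" and "inv_mat A \<in> carrier_mat n n"
    and "A * inv_mat A = 1\<^sub>m n" and "inv_mat A * A = 1\<^sub>m n"
proof -
  obtain Y where Y: "mat_inverse A = Some Y"
    using det_non_zero_imp_unit[OF A d, of "()"] mat_inverse(1)[OF A, where b = "()"]
    by (cases "mat_inverse A") auto
  from mat_inverse(2)[OF A Y] have Y': "A * Y = 1\<^sub>m n" "Y * A = 1\<^sub>m n" "Y \<in> carrier_mat n n" by auto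
  show "invertible_mat A" using inv_mat_unique(1)[OF A Y'(3,2)] .
  show "inv_mat A \<in> carrier_mat n n" "A * inv_mat A = 1\<^sub>m n" "inv_mat A * A = 1\<^sub>m n"
    using Y Y' by auto
qed

section \<open>Block matrices with conjugate symmetry\<close>

text \<open>The matrix whose first block column is \<open>(X, Y)\<close> and whose second one is forced by the
  \<open>\<Pi>\<close>-symmetry; \<open>s = 1\<close> gives the \<open>\<Pi>\<^sup>+\<close>-matrices
  and \<open>s = - 1\<close> the \<open>\<Pi>\<^sup>-\<close>-matrices. The argument \<open>Y\<close> is the lower left
  block, hence for \<open>\<Pi>\<^sup>+\<close>-matrices the conjugate of the block usually called \<open>G\<^sub>2\<close>.\<close>

definition Pi_block :: "complex \<Rightarrow> complex mat \<Rightarrow> complex mat \<Rightarrow> complex mat" where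
  "Pi_block s X Y = four_block_mat X (s \<cdot>\<^sub>m conj_mat Y) Y (s \<cdot>\<^sub>m conj_mat X)"

lemma Pi_block_carrier [simp]:
  "X \<in> carrier_mat a b \<Longrightarrow> Pi_block s X Y \<in> carrier_mat (2 * a) (2 * b)"
  unfolding Pi_block_def by (auto simp: mult_2)

text \<open>Commuting with \<open>\<Pi>\<close> up to conjugation and a sign is stable under products, and the signs
  multiply; a product of such matrices is therefore known once its first block column is. This
  halves all block computations below.\<close>

lemma Pi_block_mult:
  assumes X: "X \<in> carrier_mat a b" and Y: "Y \<in> carrier_mat a b"
    and X': "X' \<in> carrier_mat b c" and Y': "Y' \<in> carrier_mat b c"
    and s: "s = 1 \<or> s = - 1" and t: "t = 1 \<or> t = - 1"
  shows "Pi_block s X Y * Pi_block t X' Y' =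
    Pi_block (s * t) (X * X' + s \<cdot>\<^sub>m (conj_mat Y * Y')) (Y * X' + s \<cdot>\<^sub>m (conj_mat X * Y'))"
proof -
  have cc: "cnj s = s" "cnj t = t" "s * s = 1" "\<And>z. s * (s * z) = z" using s t by auto
  note c = X Y X' Y'
  have "Pi_block s X Y * Pi_block t X' Y' = four_block_mat
     (X * X' + s \<cdot>\<^sub>m conj_mat Y * Y') (X * (t \<cdot>\<^sub>m conj_mat Y') + s \<cdot>\<^sub>m conj_mat Y * (t \<cdot>\<^sub>m conj_mat X'))
     (Y * X' + s \<cdot>\<^sub>m conj_mat X * Y') (Y * (t \<cdot>\<^sub>m conj_mat Y') + s \<cdot>\<^sub>m conj_mat X * (t \<cdot>\<^sub>m conj_mat X'))"
    unfolding Pi_block_def by (rule mult_four_block_mat) (use c in auto)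
  also have "\<dots> = Pi_block (s * t) (X * X' + s \<cdot>\<^sub>m (conj_mat Y * Y')) (Y * X' + s \<cdot>\<^sub>m (conj_mat X * Y'))"
    unfolding Pi_block_def
    by (rule cong_four_block_mat; rule eq_matI)
      (use c in \<open>auto simp: scalar_prod_def cc sum_distrib_left algebra_simps\<close>)
  finally show ?thesis .
qed

lemma Pi_block_mult_real:
  assumes X: "X \<in> carrier_mat a b" and Y: "Y \<in> carrier_mat a b" and X': "X' \<in> carrier_mat b c"
    and s: "s = 1 \<or> s = - 1" and t: "t = 1 \<or> t = - 1"
  shows "Pi_block s X Y * Pi_block t X' (0\<^sub>m b c) = Pi_block (s * t) (X * X') (Y * X')"
  by (subst Pi_block_mult[OF X Y X' _ s t]) (use X Y X' in auto)

lemma Pi_block_real_mult: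
  assumes X: "X \<in> carrier_mat a b" and X': "X' \<in> carrier_mat b c" and Y': "Y' \<in> carrier_mat b c"
    and real: "conj_mat X = X"
    and s: "s = 1 \<or> s = - 1" and t: "t = 1 \<or> t = - 1"
  shows "Pi_block s X (0\<^sub>m a b) * Pi_block t X' Y' = Pi_block (s * t) (X * X') (s \<cdot>\<^sub>m (X * Y'))"
  by (subst Pi_block_mult[OF X _ X' Y' s t]) (use X X' Y' real in auto)

lemma Pi_block_adjoint:
  assumes X: "X \<in> carrier_mat a b" and Y: "Y \<in> carrier_mat a b" and s: "s = 1 \<or> s = - 1"
  shows "mat_adjoint (Pi_block s X Y) = Pi_block s (mat_adjoint X) (s \<cdot>\<^sub>m transpose_mat Y)"
  unfolding Pi_block_def
  by (rule eq_matI) (use X Y s in \<open>auto simp: mat_adjoint_eq\<close>)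

lemma Pi_block_inject:
  assumes eq: "Pi_block s X Y = Pi_block s X' Y'"
    and c: "X \<in> carrier_mat a b" "Y \<in> carrier_mat a b" "X' \<in> carrier_mat a b" "Y' \<in> carrier_mat a b"
  shows "X = X'" and "Y = Y'"
proof -
  have e: "Pi_block s X Y $$ (i, j) = Pi_block s X' Y' $$ (i, j)" for i j using eq by simp
  show "X = X'"
  proof (rule eq_matI)
    fix i j assume "i < dim_row X'" "j < dim_col X'"
    then show "X $$ (i, j) = X' $$ (i, j)" using e[of i j] c by (simp add: Pi_block_def)
  qed (use c in auto)
  show "Y = Y'"
  proof (rule eq_matI)
    fix i j assume "i < dim_row Y'" "j < dim_col Y'"
    then show "Y $$ (i, j) = Y' $$ (i, j)" using e[of "a + i" j] c by (simp add: Pi_block_def)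
  qed (use c in auto)
qed

lemma Pi_block_one: "Pi_block 1 (1\<^sub>m k) (0\<^sub>m k k) = 1\<^sub>m (2 * k)"
  unfolding Pi_block_def by (rule eq_matI) auto

section \<open>Banded matrices\<close>

text \<open>Entries below the \<open>d\<close>-th subdiagonal vanish: \<open>d = - 1, 0, 1\<close> are the strictly upper
  triangular, upper triangular and upper Hessenberg matrices. The integer index makes one product
  rule, in which the indices add, cover every combination of these classes.\<close>

definition upper_band :: "int \<Rightarrow> complex mat \<Rightarrow> bool" where
  "upper_band d M \<longleftrightarrow> (\<forall>i<dim_row M. \<forall>j<dim_col M. int j + d < int i \<longrightarrow> M $$ (i, j) = 0)"

lemma upper_bandD:
  "upper_band d M \<Longrightarrow> M \<in> carrier_mat a b \<Longrightarrow> i < a \<Longrightarrow> j < b \<Longrightarrow> int j + d < int i \<Longrightarrow>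
    M $$ (i, j) = 0"
  by (auto simp: upper_band_def)

lemma upper_band_mono: "upper_band d M \<Longrightarrow> d \<le> e \<Longrightarrow> upper_band e M"
  by (auto simp: upper_band_def)

lemma upper_triangular_iff_band:
  "M \<in> carrier_mat k k \<Longrightarrow> upper_triangular M \<longleftrightarrow> upper_band 0 M"
  by (fastforce simp: upper_band_def upper_triangular_def)

lemma strictly_upper_triangular_iff_band: "strictly_upper_triangular M \<longleftrightarrow> upper_band (- 1) M"
  by (fastforce simp: upper_band_def strictly_upper_triangular_def)

lemma upper_band_conj: "upper_band d M \<Longrightarrow> upper_band d (conj_mat M)"
  by (auto simp: upper_band_def)

lemma upper_band_uminus: "upper_band d M \<Longrightarrow> upper_band d (- M)"
  by (auto simp: upper_band_def)

lemma upper_band_add: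
  "upper_band d M \<Longrightarrow> upper_band d N \<Longrightarrow> M \<in> carrier_mat a b \<Longrightarrow> N \<in> carrier_mat a b \<Longrightarrow>
    upper_band d (M + N)"
  by (auto simp: upper_band_def)

lemma upper_band_smult: "upper_band d M \<Longrightarrow> upper_band d (c \<cdot>\<^sub>m M)"
  by (auto simp: upper_band_def)

lemma upper_band_mult:
  assumes M: "upper_band d M" "M \<in> carrier_mat a b" and N: "upper_band e N" "N \<in> carrier_mat b c"
  shows "upper_band (d + e) (M * N)"
  unfolding upper_band_def
proof (intro allI impI)
  fix i j assume ij: "i < dim_row (M * N)" "j < dim_col (M * N)" "int j + (d + e) < int i"
  have "M $$ (i, l) * N $$ (l, j) = 0" if "l < b" for l
  proof (cases "int l + d < int i")
    case True
    then show ?thesis using upper_bandD[OF M, of i l] ij M that by simp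
  next
    case False
    then show ?thesis using upper_bandD[OF N, of l j] ij N that by simp
  qed
  then show "(M * N) $$ (i, j) = 0" using ij M N by (auto simp: scalar_prod_def intro!: sum.neutral)
qed

text \<open>On the outermost diagonal a single term of the matrix product survives, so the extreme entries
  multiply.\<close>

lemma upper_band_mult_extreme:
  assumes M: "upper_band d M" "M \<in> carrier_mat a b" and N: "upper_band e N" "N \<in> carrier_mat b c"
    and i: "i < a" and l: "l < b" and j: "j < c"
    and il: "int i = int l + d" and lj: "int l = int j + e"
  shows "(M * N) $$ (i, j) = M $$ (i, l) * N $$ (l, j)"
proof -
  have "M $$ (i, l') * N $$ (l', j) = 0" if "l' < b" "l' \<noteq> l" for l'
  proof (cases "l' < l")
    case True
    then show ?thesis using upper_bandD[OF M, of i l'] il i that by simp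
  next
    case False
    then show ?thesis using upper_bandD[OF N, of l' j] lj j that by simp
  qed
  then have "(\<Sum>l'\<in>{0..<b}. M $$ (i, l') * N $$ (l', j)) =
      (\<Sum>l'\<in>{0..<b}. if l' = l then M $$ (i, l) * N $$ (l, j) else 0)"
    by (intro sum.cong) auto
  also have "\<dots> = M $$ (i, l) * N $$ (l, j)" using l by simp
  finally show ?thesis using M N i j by (simp add: scalar_prod_def)
qed

text \<open>In column \<open>j\<close> of \<open>M * N = 1\<close>, the rows \<open>i > j\<close> form a homogeneous triangular
  system; back substitution from the last row upwards shows that its solution is zero.\<close>

lemma upper_band_inverse:
  assumes M: "upper_band 0 M" "M \<in> carrier_mat k k" and d: "\<forall>i<k. M $$ (i, i) \<noteq> 0"
    and N: "N \<in> carrier_mat k k" and MN: "M * N = 1\<^sub>m k"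
  shows "upper_band 0 N"
  unfolding upper_band_def
proof (intro allI impI)
  fix i j assume "i < dim_row N" "j < dim_col N" "int j + 0 < int i"
  then have "i < k" "j < i" using N by auto
  then show "N $$ (i, j) = 0"
  proof (induction "k - i" arbitrary: i rule: less_induct)
    case less
    have z: "M $$ (i, l) * N $$ (l, j) = (if l = i then M $$ (i, i) * N $$ (i, j) else 0)"
      if "l \<in> {0..<k}" for l
    proof -
      consider "l < i" | "l = i" | "i < l" by linarith
      then show ?thesis
      proof cases
        case 1
        then show ?thesis using upper_bandD[OF M, of i l] less.prems by simp
      next
        case 3
        then show ?thesis using less.hyps[of l] less.prems that by simp
      qed simp
    qed
    have "0 = (M * N) $$ (i, j)" using less.prems by (simp add: MN)
    also have "\<dots> = (\<Sum>l\<in>{0..<k}. M $$ (i, l) * N $$ (l, j))"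
      using M N less.prems by (simp add: scalar_prod_def)
    also have "\<dots> = (\<Sum>l\<in>{0..<k}. if l = i then M $$ (i, i) * N $$ (i, j) else 0)"
      by (rule sum.cong) (use z in auto)
    also have "\<dots> = M $$ (i, i) * N $$ (i, j)" using less.prems by simp
    finally show ?case using d less.prems(1) by simp
  qed
qed

lemma det_upper_band:
  assumes M: "upper_band 0 M" "M \<in> carrier_mat k k" and d: "\<forall>i<k. M $$ (i, i) \<noteq> 0"
  shows "det M \<noteq> 0"
proof -
  have "det M = prod_list (diag_mat M)"
    using det_upper_triangular[OF _ M(2)] M upper_triangular_iff_band[OF M(2)] by blast
  then show ?thesis using d M(2) by (auto simp: prod_list_zero_iff diag_mat_def)
qed

text \<open>A permutation that never decreases a weight preserves it, so if the only nonzero entries of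
  \<open>M\<close> lie on the diagonal or strictly increase the weight \<open>w\<close> from row to column, then only the
  identity contributes to the Leibniz formula.\<close>

lemma det_weight_triangular:
  fixes w :: "nat \<Rightarrow> nat" and M :: "'a :: idom mat"
  assumes M: "M \<in> carrier_mat N N"
    and z: "\<And>i j. i < N \<Longrightarrow> j < N \<Longrightarrow> i \<noteq> j \<Longrightarrow> w j \<le> w i \<Longrightarrow> M $$ (i, j) = 0"
  shows "det M = (\<Prod>i = 0..<N. M $$ (i, i))"
proof -
  have "signof p * (\<Prod>i = 0..<N. M $$ (i, p i)) = 0"
    if p: "p permutes {0..<N}" "p \<noteq> id" for p
  proof (rule ccontr)
    assume "\<not> ?thesis"
    then have "(\<Prod>i = 0..<N. M $$ (i, p i)) \<noteq> 0" by (metis mult_zero_right)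
    then have nz: "M $$ (i, p i) \<noteq> 0" if "i < N" for i using that by auto
    have pN: "p i < N" if "i < N" for i using permutes_in_image[OF p(1), of i] that by simp
    have le: "p i = i \<or> w i < w (p i)" if "i < N" for i
      using nz[OF that] z[OF that pN[OF that]] by (metis not_le)
    obtain i where i: "p i \<noteq> i" "i < N" using p by (metis atLeastLessThan_iff eq_id_iff permutes_def)
    have "(\<Sum>i = 0..<N. w i) < (\<Sum>i = 0..<N. w (p i))"
      proof (rule sum_strict_mono_ex1)
        show "\<forall>i\<in>{0..<N}. w i \<le> w (p i)" using le by (metis atLeastLessThan_iff less_imp_le order_refl)
      qed (use le[OF i(2)] i in auto)
    moreover have "(\<Sum>i = 0..<N. w (p i)) = (\<Sum>i = 0..<N. w i)"
      using sum.permute[OF p(1), of w] by (simp add: o_def)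
    ultimately show False by simp
  qed
  then have "(\<Sum>p\<in>{p. p permutes {0..<N}} - {id}. signof p * (\<Prod>i = 0..<N. M $$ (i, p i))) = 0"
    by (intro sum.neutral) auto
  moreover have "finite {p. p permutes {0..<N}}" "id \<in> {p. p permutes {0..<N}}"
    by (auto simp: finite_permutations permutes_id)
  ultimately show ?thesis
    unfolding det_def'[OF M] by (subst sum.remove[of _ id]) auto
qed

section \<open>Selecting and shifting columns\<close>

text \<open>The matrix sending \<open>e\<^sub>j\<close> to \<open>e\<^bsub>j+d\<^esub>\<close>: right multiplication
  by it selects \<open>k\<close> of \<open>m\<close> columns, starting at column \<open>d\<close>. The case \<open>d = 0\<close>
  is the embedding of the leading part, the case \<open>d = 1\<close> is the effect of one Krylov step.\<close>

definition shift_mat :: "nat \<Rightarrow> nat \<Rightarrow> nat \<Rightarrow> complex mat" where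
  "shift_mat d m k = mat m k (\<lambda>(i, j). if i = j + d then 1 else 0)"

lemma shift_mat_carrier [simp]: "shift_mat d m k \<in> carrier_mat m k"
  by (simp add: shift_mat_def)

lemma shift_mat_dim [simp]: "dim_row (shift_mat d m k) = m" "dim_col (shift_mat d m k) = k"
  by (simp_all add: shift_mat_def)

lemma conj_shift_mat [simp]: "conj_mat (shift_mat d m k) = shift_mat d m k"
  by (rule eq_matI) (auto simp: shift_mat_def)

lemma upper_band_shift: "upper_band (int d) (shift_mat d m k)"
  by (auto simp: upper_band_def shift_mat_def)

lemma mult_monomial_col:
  fixes N :: "complex mat"
  assumes N: "N \<in> carrier_mat a b" and M: "M \<in> carrier_mat b c"
    and ij: "i < a" "j < c" and f: "f < b"
    and col: "\<And>l. l < b \<Longrightarrow> M $$ (l, j) = (if l = f then x else 0)"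
  shows "(N * M) $$ (i, j) = N $$ (i, f) * x"
proof -
  have "(N * M) $$ (i, j) = (\<Sum>l\<in>{0..<b}. N $$ (i, l) * M $$ (l, j))"
    using N M ij by (simp add: scalar_prod_def)
  also have "\<dots> = (\<Sum>l\<in>{0..<b}. if l = f then N $$ (i, f) * x else 0)"
    by (rule sum.cong) (auto simp: col)
  finally show ?thesis using f by simp
qed

lemma mult_shift_index:
  assumes N: "N \<in> carrier_mat a m" and ij: "i < a" "j < k" and d: "j + d < m"
  shows "(N * shift_mat d m k) $$ (i, j) = N $$ (i, j + d)"
  using mult_monomial_col[OF N shift_mat_carrier ij d, of d 1] ij by (simp add: shift_mat_def)

lemma shift_transpose_mult_index:
  assumes N: "N \<in> carrier_mat m c" and ij: "i < k" "j < c" and d: "i + d < m"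
  shows "(transpose_mat (shift_mat d m k) * N) $$ (i, j) = N $$ (i + d, j)"
proof -
  have "(\<Sum>l\<in>{0..<m}. shift_mat d m k $$ (l, i) * N $$ (l, j)) =
      (\<Sum>l\<in>{0..<m}. if l = i + d then N $$ (i + d, j) else 0)"
    by (rule sum.cong) (use ij in \<open>auto simp: shift_mat_def\<close>)
  then show ?thesis using N ij d by (simp add: scalar_prod_def)
qed

lemma mult_Pi_shift_index:
  assumes N: "N \<in> carrier_mat a (2 * m)" and ij: "i < a" "j < 2 * k" and d: "k + d \<le> m"
  shows "(N * Pi_block s (shift_mat d m k) (0\<^sub>m m k)) $$ (i, j) =
    (if j < k then N $$ (i, j + d) else s * N $$ (i, m + (j - k) + d))"
proof -
  let ?f = "if j < k then j + d else m + (j - k) + d"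
  have "(N * Pi_block s (shift_mat d m k) (0\<^sub>m m k)) $$ (i, j) = N $$ (i, ?f) * (if j < k then 1 else s)"
    by (rule mult_monomial_col[OF N _ ij])
      (use ij d in \<open>auto simp: Pi_block_def shift_mat_def\<close>)
  then show ?thesis by simp
qed

lemma shift_mult_index:
  assumes N: "N \<in> carrier_mat k c" and i: "i < m" and j: "j < c"
  shows "(shift_mat 0 m k * N) $$ (i, j) = (if i < k then N $$ (i, j) else 0)"
proof -
  have "(\<Sum>l\<in>{0..<k}. shift_mat 0 m k $$ (i, l) * N $$ (l, j)) =
      (\<Sum>l\<in>{0..<k}. if l = i then N $$ (i, j) else 0)"
    by (rule sum.cong) (use i in \<open>auto simp: shift_mat_def\<close>)
  then show ?thesis using N i j by (simp add: scalar_prod_def)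
qed

lemma shift_transpose_shift: "k \<le> m \<Longrightarrow> transpose_mat (shift_mat 0 m k) * shift_mat 0 m k = 1\<^sub>m k"
  by (rule eq_matI)
    (auto simp: shift_transpose_mult_index[OF shift_mat_carrier] simp del: index_mult_mat(1), auto simp: shift_mat_def)

lemma append_rows_eqI:
  assumes "M \<in> carrier_mat (k + 1) c" "T \<in> carrier_mat k c" "N \<in> carrier_mat 1 c"
    and "\<And>i j. i < k \<Longrightarrow> j < c \<Longrightarrow> M $$ (i, j) = T $$ (i, j)"
    and "\<And>j. j < c \<Longrightarrow> M $$ (k, j) = N $$ (0, j)"
  shows "M = T @\<^sub>r N"
proof (rule eq_matI)
  fix i j assume "i < dim_row (T @\<^sub>r N)" "j < dim_col (T @\<^sub>r N)"
  then have "i < k \<or> i = k" "j < c" using assms(2,3) by (auto simp: append_rows_def)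
  then show "M $$ (i, j) = (T @\<^sub>r N) $$ (i, j)" using assms by (auto simp: append_rows_def)
qed (use assms in \<open>auto simp: append_rows_def\<close>)

section \<open>The Krylov matrices\<close>

lemma Pi_mat_carrier [simp]: "Pi_mat n \<in> carrier_mat (2 * n) (2 * n)"
  by (auto simp: Pi_mat_def mult_2)

text \<open>\<open>H\<close> is a \<open>\<Pi>\<^sup>-\<close>-matrix; this is where the signs in the second block column of
  the Hessenberg form come from.\<close>

lemma Hamiltonian_Pi_commute:
  assumes A: "A \<in> carrier_mat n n" and B: "B \<in> carrier_mat n n"
    and H: "H = four_block_mat A B (- conj_mat B) (- conj_mat A)"
  shows "H * Pi_mat n = - (Pi_mat n * conj_mat H)"
proof -
  have cH: "conj_mat H = four_block_mat (conj_mat A) (conj_mat B) (- B) (- A)"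
    unfolding H by (rule eq_matI) (use A B in auto)
  have "H * Pi_mat n = four_block_mat B A (- conj_mat A) (- conj_mat B)"
    unfolding H Pi_mat_def by (subst mult_four_block_mat[of _ n n _ n _ n _ _ n _ n])
      (use A B in auto)
  moreover have "Pi_mat n * conj_mat H = four_block_mat (- B) (- A) (conj_mat A) (conj_mat B)"
    unfolding cH Pi_mat_def by (subst mult_four_block_mat[of _ n n _ n _ n _ _ n _ n])
      (use A B in auto)
  ultimately show ?thesis by (simp, intro eq_matI) (use A B in auto)
qed

lemma Pi_Krylov_carrier [simp]: "Pi_Krylov n k H q \<in> carrier_mat (2 * n) (2 * k)"
  by (rule carrier_matI) (simp_all add: Pi_Krylov_def)

lemma Pi_Krylov_index:
  assumes "i < 2 * n" "j < 2 * k"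
  shows "Pi_Krylov n k H q $$ (i, j) =
    (if j < k then ((H ^\<^sub>m j) *\<^sub>v q) $ i
     else (Pi_mat n *\<^sub>v ((conj_mat H ^\<^sub>m (j - k)) *\<^sub>v conj_vec q)) $ i)"
  using assms by (auto simp: Pi_Krylov_def mat_of_cols_index nth_append)

lemma Pi_Krylov_select:
  assumes km: "k \<le> m"
  shows "Pi_Krylov n k H q = Pi_Krylov n m H q * Pi_block 1 (shift_mat 0 m k) (0\<^sub>m m k)"
proof (rule eq_matI)
  fix i j
  assume "i < dim_row (Pi_Krylov n m H q * Pi_block 1 (shift_mat 0 m k) (0\<^sub>m m k))"
    and "j < dim_col (Pi_Krylov n m H q * Pi_block 1 (shift_mat 0 m k) (0\<^sub>m m k))"
  then have ij: "i < 2 * n" "j < 2 * k"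
    by (auto simp: Pi_Krylov_def Pi_block_def)
  show "Pi_Krylov n k H q $$ (i, j) =
      (Pi_Krylov n m H q * Pi_block 1 (shift_mat 0 m k) (0\<^sub>m m k)) $$ (i, j)"
    by (subst mult_Pi_shift_index[OF Pi_Krylov_carrier ij]) (use ij km in \<open>auto simp: Pi_Krylov_index\<close>)
qed (auto simp: Pi_Krylov_def Pi_block_def)

lemma pow_mat_Suc_left:
  assumes A: "A \<in> carrier_mat n n"
  shows "A ^\<^sub>m Suc j = A * A ^\<^sub>m j"
proof (induction j)
  case (Suc j)
  have "A ^\<^sub>m Suc (Suc j) = (A * A ^\<^sub>m j) * A" using Suc by simp
  also have "\<dots> = A * A ^\<^sub>m Suc j" using assoc_mult_mat[OF A pow_carrier_mat[OF A] A] by simp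
  finally show ?case .
qed (use A in simp)

text \<open>\<open>H\<close> moves each of the two Krylov chains one step on. In the chain that starts at
  \<open>\<Pi> (conj_vec q)\<close> every step changes the sign, because \<open>H\<close> anticommutes with \<open>\<Pi>\<close>
  up to conjugation.\<close>

lemma Hamiltonian_Krylov:
  assumes A: "A \<in> carrier_mat n n" and B: "B \<in> carrier_mat n n"
    and H: "H = four_block_mat A B (- conj_mat B) (- conj_mat A)"
    and q: "q \<in> carrier_vec (2 * n)" and km: "k < m"
  shows "H * Pi_Krylov n k H q = Pi_Krylov n m H q * Pi_block (- 1) (shift_mat 1 m k) (0\<^sub>m m k)"
    (is "?L = ?R")
proof (rule eq_matI)
  have Hc: "H \<in> carrier_mat (2 * n) (2 * n)" unfolding H using A B by (auto simp: mult_2)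
  then have cHc: "conj_mat H \<in> carrier_mat (2 * n) (2 * n)" by auto
  fix i j assume "i < dim_row ?R" "j < dim_col ?R"
  then have ij: "i < 2 * n" "j < 2 * k" by (auto simp: Pi_Krylov_def Pi_block_def)
  have L: "?L $$ (i, j) = (H *\<^sub>v col (Pi_Krylov n k H q) j) $ i"
    using ij Hc carrier_matD[OF Pi_Krylov_carrier, of n k H q] by simp
  have R: "?R $$ (i, j) = (if j < k then Pi_Krylov n m H q $$ (i, j + 1)
      else - 1 * Pi_Krylov n m H q $$ (i, m + (j - k) + 1))"
    by (rule mult_Pi_shift_index[OF Pi_Krylov_carrier ij]) (use km in simp)
  show "?L $$ (i, j) = ?R $$ (i, j)"
  proof (cases "j < k")
    case True
    have "col (Pi_Krylov n k H q) j = (H ^\<^sub>m j) *\<^sub>v q"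
      by (rule eq_vecI)
        (use True ij carrier_matD[OF Pi_Krylov_carrier, of n k H q] pow_carrier_mat[OF Hc, of j] in
          \<open>auto simp: Pi_Krylov_index simp del: index_mult_mat_vec\<close>)
    moreover have "H *\<^sub>v ((H ^\<^sub>m j) *\<^sub>v q) = (H ^\<^sub>m Suc j) *\<^sub>v q"
      unfolding pow_mat_Suc_left[OF Hc]
      by (rule assoc_mult_mat_vec[symmetric, OF Hc pow_carrier_mat[OF Hc] q])
    ultimately show ?thesis unfolding L R using True ij km by (simp add: Pi_Krylov_index)
  next
    case False
    define v where "v = (conj_mat H ^\<^sub>m (j - k)) *\<^sub>v conj_vec q"
    have v: "v \<in> carrier_vec (2 * n)"
      unfolding v_def using pow_carrier_mat[OF cHc, of "j - k"] q by auto
    have cl: "col (Pi_Krylov n k H q) j = Pi_mat n *\<^sub>v v"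
      by (rule eq_vecI)
        (use False ij carrier_matD[OF Pi_Krylov_carrier, of n k H q] carrier_matD[OF Pi_mat_carrier, of n] in
          \<open>auto simp: Pi_Krylov_index v_def simp del: index_mult_mat_vec\<close>)
    have s: "conj_mat H *\<^sub>v v = (conj_mat H ^\<^sub>m Suc (j - k)) *\<^sub>v conj_vec q"
      unfolding pow_mat_Suc_left[OF cHc] v_def
      by (rule assoc_mult_mat_vec[symmetric, OF cHc pow_carrier_mat[OF cHc]]) (use q in auto)
    have "H *\<^sub>v (Pi_mat n *\<^sub>v v) = (H * Pi_mat n) *\<^sub>v v"
      by (rule assoc_mult_mat_vec[symmetric, OF Hc Pi_mat_carrier v])
    also have "\<dots> = - ((Pi_mat n * conj_mat H) *\<^sub>v v)"
      unfolding Hamiltonian_Pi_commute[OF A B H]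
      by (rule uminus_mult_mat_vec) (use v Hc in auto)
    also have "(Pi_mat n * conj_mat H) *\<^sub>v v = Pi_mat n *\<^sub>v (conj_mat H *\<^sub>v v)"
      by (rule assoc_mult_mat_vec[OF Pi_mat_carrier cHc v])
    finally have "H *\<^sub>v (Pi_mat n *\<^sub>v v) =
        - (Pi_mat n *\<^sub>v ((conj_mat H ^\<^sub>m Suc (j - k)) *\<^sub>v conj_vec q))" unfolding s .
    moreover have "Pi_Krylov n m H q $$ (i, m + (j - k) + 1) =
        (Pi_mat n *\<^sub>v ((conj_mat H ^\<^sub>m Suc (j - k)) *\<^sub>v conj_vec q)) $ i"
    proof -
      have "m + (j - k) + 1 < 2 * m" using ij km by linarith
      moreover have "(m + (j - k) + 1 < m) = False" "m + (j - k) + 1 - m = Suc (j - k)" by simp_all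
      ultimately show ?thesis using Pi_Krylov_index[OF ij(1)] by (simp only: if_False)
    qed
    ultimately show ?thesis unfolding L R cl using False ij carrier_matD[OF Pi_mat_carrier, of n]
      by (simp del: index_mult_mat_vec)
  qed
qed (auto simp: Pi_Krylov_def Pi_block_def H A B, (use A in auto)?)

section \<open>Inverse of a triangular matrix with conjugate symmetry\<close>

text \<open>The correction term \<open>conj_mat S * inv_mat (conj_mat P) * S\<close> contains two strictly upper triangular
  factors, so it has band index \<open>- 2\<close>. It cannot reach the diagonal, and the Schur complement
  inherits both triangularity and nonsingularity from \<open>P\<close>.\<close>

lemma Schur_complement_band:
  assumes P: "P \<in> carrier_mat k k" "upper_band 0 P" and d: "\<forall>i<k. P $$ (i, i) \<noteq> 0"
    and S: "S \<in> carrier_mat k k" "upper_band (- 1) S"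
  defines "C \<equiv> P - conj_mat S * inv_mat (conj_mat P) * S"
  shows "C \<in> carrier_mat k k" and "upper_band 0 C" and "\<forall>i<k. C $$ (i, i) \<noteq> 0"
    and "det P \<noteq> 0" and "det (conj_mat P) \<noteq> 0" and "det C \<noteq> 0"
    and "upper_band 0 (inv_mat (conj_mat P))"
proof -
  have cP: "conj_mat P \<in> carrier_mat k k" "upper_band 0 (conj_mat P)"
    using P by (auto intro: upper_band_conj)
  have cd: "\<forall>i<k. conj_mat P $$ (i, i) \<noteq> 0" using d P by simp
  show "det P \<noteq> 0" using det_upper_band[OF P(2,1) d] .
  show dc: "det (conj_mat P) \<noteq> 0" using det_upper_band[OF cP(2,1) cd] .
  note I = inv_mat_det[OF cP(1) dc]
  show band: "upper_band 0 (inv_mat (conj_mat P))"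
    using upper_band_inverse[OF cP(2,1) cd I(2,3)] .
  have cS: "conj_mat S \<in> carrier_mat k k" "upper_band (- 1) (conj_mat S)"
    using S by (auto intro: upper_band_conj)
  let ?X = "conj_mat S * inv_mat (conj_mat P) * S"
  have Xc: "?X \<in> carrier_mat k k" using cS I S by auto
  have "upper_band (- 1 + 0 + - 1) ?X"
    by (intro upper_band_mult[where a = k and b = k and c = k] cS I band S mult_carrier_mat[where n = k])
  then have X: "?X $$ (i, j) = 0" if "i < k" "j < k" "j \<le> i + 1" for i j
    using upper_bandD[OF _ Xc, of "- 2" i j] that by simp
  show C: "C \<in> carrier_mat k k" unfolding C_def by (rule minus_carrier_mat[OF Xc])
  have ent: "C $$ (i, j) = P $$ (i, j)" if "i < k" "j < k" "j \<le> i + 1" for i j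
    unfolding C_def using index_minus_mat(1)[of i ?X j P] X[OF that] carrier_matD[OF Xc] that by simp
  show bC: "upper_band 0 C"
    unfolding upper_band_def using carrier_matD[OF C] ent upper_bandD[OF P(2,1)] by auto
  show dC: "\<forall>i<k. C $$ (i, i) \<noteq> 0" using ent d by simp
  show "det C \<noteq> 0" using det_upper_band[OF bC C dC] .
qed

lemma conj_inv_mat:
  assumes A: "A \<in> carrier_mat k k" and d: "det A \<noteq> 0"
  shows "inv_mat (conj_mat A) = conj_mat (inv_mat A)"
proof (rule inv_mat_unique(2))
  note I = inv_mat_det[OF A d]
  show "conj_mat (inv_mat A) * conj_mat A = 1\<^sub>m k"
    using conj_mat_mult[OF I(2) A] I(4) by simp
qed (use A inv_mat_det[OF A d] in auto)

text \<open>The two Schur complements are conjugate to each other, hence so are \<open>X\<close> and \<open>X'\<close>, and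
  likewise \<open>Z\<close> and \<open>Y\<close>. The candidate inverse is therefore again a \<open>\<Pi>\<^sup>+\<close>-matrix, and it
  suffices to compute the first block column of its product with \<open>Pi_block 1 P S\<close>.\<close>

lemma Pi_block_inverse:
  assumes P: "P \<in> carrier_mat k k" "upper_band 0 P" and d: "\<forall>i<k. P $$ (i, i) \<noteq> 0"
    and S: "S \<in> carrier_mat k k" "upper_band (- 1) S"
  defines "X \<equiv> inv_mat (P - conj_mat S * inv_mat (conj_mat P) * S)"
  defines "X' \<equiv> inv_mat (conj_mat P - S * inv_mat P * conj_mat S)"
  defines "Z \<equiv> - (X * conj_mat S * inv_mat (conj_mat P))"
  defines "Y \<equiv> - (X' * S * inv_mat P)"
  shows "invertible_mat (Pi_block 1 P S)" and "invertible_mat P" and "invertible_mat (conj_mat P)"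
    and "invertible_mat (P - conj_mat S * inv_mat (conj_mat P) * S)"
    and "invertible_mat (conj_mat P - S * inv_mat P * conj_mat S)"
    and "inv_mat (Pi_block 1 P S) = four_block_mat X Z Y X'"
    and "inv_mat (Pi_block 1 P S) = Pi_block 1 X Y"
    and "Pi_block 1 X Y * Pi_block 1 P S = 1\<^sub>m (2 * k)"
    and "Pi_block 1 P S * Pi_block 1 X Y = 1\<^sub>m (2 * k)"
    and "X \<in> carrier_mat k k" and "Y \<in> carrier_mat k k"
    and "upper_band 0 X" and "upper_band (- 1) Z" and "upper_band (- 1) Y"
    and "\<forall>i<k. X $$ (i, i) \<noteq> 0"
proof -
  let ?C = "P - conj_mat S * inv_mat (conj_mat P) * S"
  note C = Schur_complement_band[OF P d S]
  have cP: "conj_mat P \<in> carrier_mat k k" using P by auto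
  have cS: "conj_mat S \<in> carrier_mat k k" using S by auto
  note I = inv_mat_det[OF P(1) C(4)] and J = inv_mat_det[OF cP C(5)] and K = inv_mat_det[OF C(1) C(6)]
  have iP: "inv_mat (conj_mat P) = conj_mat (inv_mat P)" using conj_inv_mat[OF P(1) C(4)] .
  have C': "conj_mat P - S * inv_mat P * conj_mat S = conj_mat ?C"
  proof -
    have "conj_mat ?C = conj_mat P - conj_mat (conj_mat S * inv_mat (conj_mat P) * S)"
      by (rule eq_matI) (use P S in auto)
    also have "conj_mat (conj_mat S * inv_mat (conj_mat P) * S) = S * inv_mat P * conj_mat S"
      unfolding iP using conj_mat_mult[of "conj_mat S * conj_mat (inv_mat P)" k k S k]
        conj_mat_mult[of "conj_mat S" k k "conj_mat (inv_mat P)" k] cS I S by auto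
    finally show ?thesis by simp
  qed
  have X': "X' = conj_mat X" unfolding X'_def X_def C' using conj_inv_mat[OF C(1,6)] .
  have X: "X \<in> carrier_mat k k" "X * ?C = 1\<^sub>m k" "?C * X = 1\<^sub>m k"
    using K by (auto simp: X_def)
  have cX: "conj_mat X \<in> carrier_mat k k" using X by auto
  have Z: "Z = conj_mat Y"
    unfolding Z_def Y_def X' iP conj_mat_uminus
    using conj_mat_mult[of "conj_mat X * S" k k "inv_mat P" k]
        conj_mat_mult[of "conj_mat X" k k S k] cX I S by auto
  have Zc: "Z \<in> carrier_mat k k" unfolding Z_def using X cS J by auto
  have Yc: "Y \<in> carrier_mat k k" unfolding Y_def X' using cX S I by auto
  show "invertible_mat P" "invertible_mat (conj_mat P)" "invertible_mat ?C" using I J K by auto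
  have "det (conj_mat ?C) \<noteq> 0"
  proof (rule det_upper_band[OF upper_band_conj[OF C(2)]])
    show "\<forall>i<k. conj_mat ?C $$ (i, i) \<noteq> 0"
      using C(3) carrier_matD[OF C(1)] index_map_mat(1)[of _ ?C _ cnj] by simp
  qed (use C(1) in simp)
  then show "invertible_mat (conj_mat P - S * inv_mat P * conj_mat S)"
    unfolding C' using inv_mat_det(1)[of "conj_mat ?C" k] C(1) by auto
  have XS: "X * conj_mat S \<in> carrier_mat k k" using X cS by auto
  have e1: "X * P + Z * S = 1\<^sub>m k"
  proof -
    have "Z * S = - (X * conj_mat S * inv_mat (conj_mat P) * S)"
      unfolding Z_def using XS J S by (intro uminus_mult_left_mat) auto
    also have "X * conj_mat S * inv_mat (conj_mat P) * S = X * (conj_mat S * inv_mat (conj_mat P) * S)"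
      using X cS J S by (simp add: assoc_mult_mat[where n\<^sub>2 = k and n\<^sub>3 = k and n\<^sub>4 = k and n\<^sub>1 = k])
    finally have "X * P + Z * S = X * P - X * (conj_mat S * inv_mat (conj_mat P) * S)"
      using X P cS J S by (intro eq_matI) auto
    also have "\<dots> = X * ?C"
      by (rule mult_minus_distrib_mat[symmetric]) (use X P cS J S in auto)
    finally show ?thesis using X by simp
  qed
  have e2: "X * conj_mat S + Z * conj_mat P = 0\<^sub>m k k"
  proof -
    have "Z * conj_mat P = - (X * conj_mat S * inv_mat (conj_mat P) * conj_mat P)"
      unfolding Z_def using XS J P by (intro uminus_mult_left_mat) auto
    also have "X * conj_mat S * inv_mat (conj_mat P) * conj_mat P = X * conj_mat S"
      using assoc_mult_mat[OF XS J(2) cP] J(4) right_mult_one_mat[OF XS] by simp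
    finally show ?thesis using XS comm_add_mat[OF XS, of "- (X * conj_mat S)"] by simp
  qed
  show inv: "Pi_block 1 X Y * Pi_block 1 P S = 1\<^sub>m (2 * k)"
  proof -
    have "conj_mat (X * conj_mat S + Z * conj_mat P) = conj_mat X * S + Y * P"
      using conj_mat_mult[OF X(1) cS] conj_mat_mult[OF Zc cP]
      unfolding Z by (intro eq_matI) (use X S Yc P in \<open>auto simp: scalar_prod_def\<close>)
    then have "Y * P + conj_mat X * S = 0\<^sub>m k k"
      using e2 cX S Yc P by (simp add: comm_add_mat[of "Y * P" k k])
    then have "Pi_block 1 X Y * Pi_block 1 P S = Pi_block 1 (1\<^sub>m k) (0\<^sub>m k k)"
      using Pi_block_mult[OF X(1) Yc P(1) S(1), of 1 1] e1 Z
      by simp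
    then show ?thesis by (simp add: Pi_block_one)
  qed
  have PS: "Pi_block 1 P S \<in> carrier_mat (2 * k) (2 * k)" using P S by simp
  have XY: "Pi_block 1 X Y \<in> carrier_mat (2 * k) (2 * k)" using X Yc by simp
  show "invertible_mat (Pi_block 1 P S)" and i: "inv_mat (Pi_block 1 P S) = Pi_block 1 X Y"
    using inv_mat_unique[OF PS XY inv] by auto
  show "Pi_block 1 P S * Pi_block 1 X Y = 1\<^sub>m (2 * k)"
    using mat_mult_left_right_inverse[OF XY PS inv] .
  show "inv_mat (Pi_block 1 P S) = four_block_mat X Z Y X'"
    unfolding i by (simp add: Z X' Pi_block_def)
  show "X \<in> carrier_mat k k" "Y \<in> carrier_mat k k" using X Yc by auto
  show bX: "upper_band 0 X" using upper_band_inverse[OF C(2,1,3) X(1,3)] by simp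
  have "upper_band (0 + - 1 + 0) (X * conj_mat S * inv_mat (conj_mat P))"
    by (intro upper_band_mult[where a = k and b = k and c = k] X bX cS upper_band_conj S C(7) J
        mult_carrier_mat[where n = k])
  then show bZ: "upper_band (- 1) Z" unfolding Z_def by (simp add: upper_band_uminus)
  then show "upper_band (- 1) Y" using Z upper_band_conj[OF bZ] by simp
  show "\<forall>i<k. X $$ (i, i) \<noteq> 0"
  proof (intro allI impI)
    fix i assume "i < k"
    then show "X $$ (i, i) \<noteq> 0"
      using upper_band_mult_extreme[OF bX X(1) C(2,1), of i i i] X by auto
  qed
qed

section \<open>Nonsingularity from the leading minors\<close>

text \<open>Interleaving the two halves of the indices would make \<open>Pi_block s P S\<close> upper triangular;
  instead of permuting, the index modulo \<open>m\<close> serves as the weight for the determinant formula.\<close>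

lemma Pi_upper_triangular_diag_nonzero:
  assumes P: "P \<in> carrier_mat m m" "upper_band 0 P" and S: "S \<in> carrier_mat m m" "upper_band (- 1) S"
    and d: "det (Pi_block s P S) \<noteq> 0" and i: "i < m"
  shows "P $$ (i, i) \<noteq> 0"
proof -
  let ?M = "Pi_block s P S"
  have M: "?M \<in> carrier_mat (2 * m) (2 * m)" using P S by simp
  have z: "?M $$ (a, b) = 0" if ab: "a < 2 * m" "b < 2 * m" "a \<noteq> b" "b mod m \<le> a mod m" for a b
  proof -
    have md: "x mod m = (if x < m then x else x - m)" if "x < 2 * m" for x
      using that by (auto simp: mod_if)
    show ?thesis using ab(3,4) P S ab(1,2) unfolding md[OF ab(1)] md[OF ab(2)] Pi_block_def
      by (auto split: if_splits intro: upper_bandD[OF P(2,1)] upper_bandD[OF S(2,1)])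
  qed
  have "det ?M = (\<Prod>i = 0..<2 * m. ?M $$ (i, i))"
    by (rule det_weight_triangular[OF M, where w = "\<lambda>i. i mod m"]) (use z in blast)
  then have "?M $$ (i, i) \<noteq> 0" using d i by simp
  then show ?thesis using i P S by (simp add: Pi_block_def)
qed

text \<open>The leading minor only reads the two upper blocks and rebuilds the lower ones; for a matrix that
  has the symmetry, nothing is lost.\<close>

lemma Pi_leading_minor_full:
  assumes X: "X \<in> carrier_mat m m" and Y: "Y \<in> carrier_mat m m" and s: "s = 1 \<or> s = - 1"
  shows "Pi_leading_minor s m (Pi_block s X Y) m = det (Pi_block s X Y)"
proof -
  have "mat m m (\<lambda>(a, b). Pi_block s X Y $$ (a, b)) = X"
    by (rule eq_matI) (use X Y in \<open>auto simp: Pi_block_def\<close>)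
  moreover have "mat m m (\<lambda>(a, b). Pi_block s X Y $$ (a, m + b)) = s \<cdot>\<^sub>m conj_mat Y"
    by (rule eq_matI) (use X Y in \<open>auto simp: Pi_block_def\<close>)
  moreover have "s \<cdot>\<^sub>m conj_mat (s \<cdot>\<^sub>m conj_mat Y) = Y"
    by (rule eq_matI) (use s in auto)
  ultimately show ?thesis unfolding Pi_leading_minor_def Let_def by (simp add: Pi_block_def)
qed

text \<open>The Gram matrix of a factored Krylov matrix has the form \<open>R\<^sup>H G R\<close>. As a product of
  \<open>\<Pi>\<close>-symmetric matrices it is \<open>\<Pi>\<close>-symmetric, so its last leading minor is its determinant,
  of which \<open>det R\<close> is a factor.\<close>

lemma det_Pi_factor_nonzero:
  assumes J: "J \<in> carrier_mat m m" and P: "P \<in> carrier_mat m m" and S: "S \<in> carrier_mat m m"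
    and minor: "Pi_leading_minor (- 1) m
      (mat_adjoint (Pi_block 1 P S) * Pi_block (- 1) J (0\<^sub>m m m) * Pi_block 1 P S) m \<noteq> 0"
  shows "det (Pi_block 1 P S) \<noteq> 0"
proof -
  let ?R = "Pi_block 1 P S" and ?G = "Pi_block (- 1) J (0\<^sub>m m m)"
  have c: "?R \<in> carrier_mat (2 * m) (2 * m)" "?G \<in> carrier_mat (2 * m) (2 * m)"
    "mat_adjoint ?R * ?G \<in> carrier_mat (2 * m) (2 * m)"
    using J P S by (auto intro!: mult_carrier_mat[where n = "2 * m"])
  have "mat_adjoint ?R * ?G =
      Pi_block (- 1) (mat_adjoint P * J) (transpose_mat S * J)"
    unfolding Pi_block_adjoint[OF P S disjI1[OF refl]]
    by (subst Pi_block_mult_real[where a = m and b = m]) (use P S J in \<open>auto simp: mat_adjoint_eq\<close>)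
  moreover have PJ: "mat_adjoint P * J \<in> carrier_mat m m" and SJ: "transpose_mat S * J \<in> carrier_mat m m"
    using P S J by (auto intro!: mult_carrier_mat[where n = m])
  moreover define X where "X = mat_adjoint P * J * P + - 1 \<cdot>\<^sub>m (conj_mat (transpose_mat S * J) * S)"
  moreover define Y where "Y = transpose_mat S * J * P + - 1 \<cdot>\<^sub>m (conj_mat (mat_adjoint P * J) * S)"
  ultimately have eq: "mat_adjoint ?R * ?G * ?R = Pi_block (- 1) X Y"
    using Pi_block_mult[OF PJ SJ P S, of "- 1" 1] by simp
  have cc: "conj_mat (transpose_mat S * J) * S \<in> carrier_mat m m" "conj_mat (mat_adjoint P * J) * S \<in> carrier_mat m m"
    by (rule mult_carrier_mat[OF _ S], use PJ SJ in simp)+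
  have XY: "X \<in> carrier_mat m m" "Y \<in> carrier_mat m m"
    unfolding X_def Y_def using cc by simp_all
  have "det (mat_adjoint ?R * ?G * ?R) \<noteq> 0"
    using minor Pi_leading_minor_full[OF XY(1,2), of "- 1"] unfolding eq by simp
  then show ?thesis using det_mult[OF c(3,1)] by auto
qed

section \<open>Hessenberg form and Hermitian symmetry\<close>

text \<open>The coefficient matrix of \<open>H\<close> in the new basis is \<open>R\<close> times the shift times the inverse of the
  leading part of \<open>R\<close>. Counting bands, the terms of its upper block have indices \<open>0 + 1 + 0\<close>
  and \<open>- 1 + 1 - 1\<close>, those of its lower block \<open>- 1 + 1 + 0\<close> and \<open>0 + 1 - 1\<close>.
  The only term that reaches the subdiagonal is the first one, which gives the subdiagonal entries.\<close>

lemma Hessenberg_product: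
  fixes k :: nat
  assumes P: "P \<in> carrier_mat (k + 1) (k + 1)" "upper_band 0 P"
    and S: "S \<in> carrier_mat (k + 1) (k + 1)" "upper_band (- 1) S"
    and X: "X \<in> carrier_mat k k" "upper_band 0 X"
    and Y: "Y \<in> carrier_mat k k" "upper_band (- 1) Y"
  obtains W V where "W \<in> carrier_mat (k + 1) k" "V \<in> carrier_mat (k + 1) k"
    "upper_band 1 W" "upper_band 0 V"
    "\<And>j. j < k \<Longrightarrow> W $$ (j + 1, j) = P $$ (j + 1, j + 1) * X $$ (j, j)"
    "Pi_block 1 P S * Pi_block (- 1) (shift_mat 1 (k + 1) k) (0\<^sub>m (k + 1) k) * Pi_block 1 X Y =
      Pi_block (- 1) W V"
proof -
  let ?m = "k + 1"
  let ?F = "shift_mat 1 ?m k"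
  have F: "?F \<in> carrier_mat ?m k" "upper_band 1 ?F" using upper_band_shift[of 1 ?m k] by auto
  have PF: "P * ?F \<in> carrier_mat ?m k" "upper_band 1 (P * ?F)"
    using upper_band_mult[OF P(2,1) F(2,1)] P F by auto
  have SF: "S * ?F \<in> carrier_mat ?m k" "upper_band 0 (S * ?F)"
    using upper_band_mult[OF S(2,1) F(2,1)] S F by auto
  have cPF: "conj_mat (P * ?F) \<in> carrier_mat ?m k" "upper_band 1 (conj_mat (P * ?F))"
    using PF upper_band_conj by auto
  have cSF: "conj_mat (S * ?F) \<in> carrier_mat ?m k" "upper_band 0 (conj_mat (S * ?F))"
    using SF upper_band_conj by auto
  define W1 where "W1 = P * ?F * X"
  define W2 where "W2 = - 1 \<cdot>\<^sub>m (conj_mat (S * ?F) * Y)"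
  define V1 where "V1 = S * ?F * X"
  define V2 where "V2 = - 1 \<cdot>\<^sub>m (conj_mat (P * ?F) * Y)"
  have W1: "W1 \<in> carrier_mat ?m k" "upper_band 1 W1"
    unfolding W1_def using upper_band_mult[OF PF(2,1) X(2,1)] PF X by auto
  have W2: "W2 \<in> carrier_mat ?m k" "upper_band (- 1) W2"
    unfolding W2_def using upper_band_smult[OF upper_band_mult[OF cSF(2,1) Y(2,1)]]
      mult_carrier_mat[OF cSF(1) Y(1)] by auto
  have V1: "V1 \<in> carrier_mat ?m k" "upper_band 0 V1"
    unfolding V1_def using upper_band_mult[OF SF(2,1) X(2,1)] SF X by auto
  have V2: "V2 \<in> carrier_mat ?m k" "upper_band 0 V2"
    unfolding V2_def using upper_band_smult[OF upper_band_mult[OF cPF(2,1) Y(2,1)]]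
      mult_carrier_mat[OF cPF(1) Y(1)] by auto
  have eq: "Pi_block 1 P S * Pi_block (- 1) ?F (0\<^sub>m ?m k) * Pi_block 1 X Y =
      Pi_block (- 1) (W1 + W2) (V1 + V2)"
    using Pi_block_mult_real[OF P(1) S(1) F(1), of 1 "- 1"]
      Pi_block_mult[OF PF(1) SF(1) X(1) Y(1), of "- 1" 1]
    by (simp add: W1_def W2_def V1_def V2_def)
  have sub: "(W1 + W2) $$ (j + 1, j) = P $$ (j + 1, j + 1) * X $$ (j, j)" if j: "j < k" for j
  proof -
    have "W1 $$ (j + 1, j) = (P * ?F) $$ (j + 1, j) * X $$ (j, j)"
      unfolding W1_def by (rule upper_band_mult_extreme[OF PF(2,1) X(2,1)]) (use j in auto)
    also have "(P * ?F) $$ (j + 1, j) = P $$ (j + 1, j + 1)"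
      using mult_shift_index[OF P(1), of "j + 1" j k 1] j by simp
    finally show ?thesis
      using upper_bandD[OF W2(2,1), of "j + 1" j] W1 W2 j by simp
  qed
  show thesis
    by (rule that[OF _ _ _ _ sub eq])
      (use W1 W2 V1 V2 upper_band_add[OF W1(2) upper_band_mono[OF W2(2), of 1] W1(1) W2(1)]
        upper_band_add[OF V1(2) V2(2) V1(1) V2(1)] in auto)
qed

lemma diagonal_mult_index:
  fixes D :: "complex mat"
  assumes D: "D \<in> carrier_mat k k" "diagonal_mat D" and T: "T \<in> carrier_mat k c"
    and ij: "i < k" "j < c"
  shows "(D * T) $$ (i, j) = D $$ (i, i) * T $$ (i, j)"
proof -
  have "(\<Sum>l\<in>{0..<k}. D $$ (i, l) * T $$ (l, j)) =
      (\<Sum>l\<in>{0..<k}. if l = i then D $$ (i, i) * T $$ (i, j) else 0)"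
    by (rule sum.cong) (use D ij in \<open>auto simp: diagonal_mat_def\<close>)
  then show ?thesis using D T ij by (simp add: scalar_prod_def)
qed

text \<open>For \<open>D * T\<close> Hermitian, a zero below the band is also a zero above it, and a row scaling by
  nonzero numbers does not move zeros.\<close>

lemma Hermitian_Hessenberg_tridiagonal:
  assumes D: "D \<in> carrier_mat k k" "diagonal_mat D" "\<forall>i<k. D $$ (i, i) \<noteq> 0"
    and T: "T \<in> carrier_mat k k" "upper_band 1 T" and herm: "mat_adjoint (D * T) = D * T"
  shows "tridiagonal_mat T"
proof -
  have DT: "D * T \<in> carrier_mat k k" using D(1) T(1) by (rule mult_carrier_mat)
  have "T $$ (i, j) = 0" if ij: "i < k" "j < k" "j + 1 < i \<or> i + 1 < j" for i j
    using ij(3)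
  proof
    assume "j + 1 < i"
    then show ?thesis using upper_bandD[OF T(2,1) ij(1,2)] by simp
  next
    assume "i + 1 < j"
    then have "T $$ (j, i) = 0" using upper_bandD[OF T(2,1) ij(2,1)] by simp
    then have "(D * T) $$ (j, i) = 0" using diagonal_mult_index[OF D(1,2) T(1) ij(2,1)] by simp
    then have "(D * T) $$ (i, j) = 0"
      using mat_adjoint_index[of i "D * T" j] herm carrier_matD[OF DT] ij by simp
    then show ?thesis using diagonal_mult_index[OF D(1,2) T(1) ij(1,2)] D(3) ij(1) by simp
  qed
  then show ?thesis using T(1) unfolding tridiagonal_mat_def by auto
qed

lemma symmetric_upper_triangular_diagonal:
  assumes D: "D \<in> carrier_mat k k" "diagonal_mat D" "\<forall>i<k. D $$ (i, i) \<noteq> 0"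
    and T: "T \<in> carrier_mat k k" "upper_band 0 T" and sym: "transpose_mat (D * T) = D * T"
  shows "diagonal_mat T"
  unfolding diagonal_mat_def
proof (intro allI impI)
  have DT: "D * T \<in> carrier_mat k k" using D(1) T(1) by (rule mult_carrier_mat)
  fix i j assume "i < dim_row T" "j < dim_col T" "i \<noteq> j"
  then have ij: "i < k" "j < k" "i \<noteq> j" using T by auto
  show "T $$ (i, j) = 0"
  proof (cases "j < i")
    case True
    then show ?thesis using upper_bandD[OF T(2,1) ij(1,2)] by simp
  next
    case False
    then have "(D * T) $$ (j, i) = 0"
      using diagonal_mult_index[OF D(1,2) T(1) ij(2,1)] upper_bandD[OF T(2,1) ij(2,1)] ij by simp
    then have "(D * T) $$ (i, j) = 0"
      using index_transpose_mat(1)[of i "D * T" j] sym carrier_matD[OF DT] ij by simp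
    then show ?thesis using diagonal_mult_index[OF D(1,2) T(1) ij(1,2)] D(3) ij(1) by simp
  qed
qed

lemma Gamma0_Hamiltonian_Hermitian:
  assumes A: "A \<in> carrier_mat n n" "mat_adjoint A = A" and B: "B \<in> carrier_mat n n" "transpose_mat B = B"
    and H: "H = four_block_mat A B (- conj_mat B) (- conj_mat A)"
  shows "mat_adjoint (Gamma0 n * H) = Gamma0 n * H"
proof -
  have eq: "Gamma0 n * H = four_block_mat A B (conj_mat B) (conj_mat A)"
    unfolding Gamma0_def H
    by (subst mult_four_block_mat[of _ n n _ n _ n _ _ n _ n]) (use A B in \<open>auto simp: uminus_mult_left_mat\<close>)
  have sA: "cnj (A $$ (j, i)) = A $$ (i, j)" if "i < n" "j < n" for i j
    using mat_adjoint_index[of i A j] A that by simp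
  have sB: "B $$ (j, i) = B $$ (i, j)" if "i < n" "j < n" for i j
    using index_transpose_mat(1)[of i B j] B that by simp
  have "mat_adjoint (four_block_mat A B (conj_mat B) (conj_mat A)) =
      four_block_mat A B (conj_mat B) (conj_mat A)"
  proof (rule eq_matI)
    fix i j assume "i < dim_row (four_block_mat A B (conj_mat B) (conj_mat A))"
      "j < dim_col (four_block_mat A B (conj_mat B) (conj_mat A))"
    then show "mat_adjoint (four_block_mat A B (conj_mat B) (conj_mat A)) $$ (i, j) =
        four_block_mat A B (conj_mat B) (conj_mat A) $$ (i, j)"
      using A(1) B(1) sA[of i j] sA[of "j - n" "i - n"] sB[of i "j - n"] sB[of "i - n" j]
      by (auto simp: mat_adjoint_eq)
  qed (use A(1) B(1) in \<open>auto simp: mat_adjoint_eq\<close>)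
  then show ?thesis unfolding eq .
qed

section \<open>The Lanczos relation for the Krylov basis\<close>

theorem theorem4p3:
  fixes n k :: nat
    and A B H K R R2k Q Q2k G G2k Rt Rs U D :: "complex mat"
    and q1 rt rs u :: "complex vec"
    and \<tau> \<delta> \<zeta> :: complex
  assumes k: "k \<ge> 1"
    and A: "A \<in> carrier_mat n n" "mat_adjoint A = A"
    and B: "B \<in> carrier_mat n n" "transpose_mat B = B"
    and H: "H = four_block_mat A B (- conj_mat B) (- conj_mat A)"
    and q1: "q1 \<in> carrier_vec (2 * n)"
    and K: "K = Pi_Krylov n (k + 1) H q1"
    and minors: "\<forall>i\<in>{1..k + 1}. Pi_leading_minor (- 1) (k + 1) (mat_adjoint K * Gamma0 n * K) i \<noteq> 0"
    and QR: "is_Gamma_QR n (k + 1) K Q R"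
    and G: "G = mat_adjoint Q * Gamma0 n * Q"
    and Rt: "Rt \<in> carrier_mat k k" "upper_triangular Rt"
    and Rs: "Rs \<in> carrier_mat k k" "strictly_upper_triangular Rs"
    and rt: "rt \<in> carrier_vec k" and rs: "rs \<in> carrier_vec k"
    and R: "R = four_block_mat
        (four_block_mat Rt (mat_of_cols k [rt]) (0\<^sub>m 1 k) (scalar_mat \<tau>))
        (four_block_mat (conj_mat Rs) (mat_of_cols k [conj_vec rs]) (0\<^sub>m 1 k) (0\<^sub>m 1 1))
        (four_block_mat Rs (mat_of_cols k [rs]) (0\<^sub>m 1 k) (0\<^sub>m 1 1))
        (four_block_mat (conj_mat Rt) (mat_of_cols k [conj_vec rt]) (0\<^sub>m 1 k) (scalar_mat (cnj \<tau>)))"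
    and R2k: "R2k = four_block_mat Rt (conj_mat Rs) Rs (conj_mat Rt)"
    and U: "U \<in> carrier_mat (2 * n) k" and u: "u \<in> carrier_vec (2 * n)"
    and Q: "Q = mat_of_cols (2 * n)
        (cols U @ [u] @ cols (Pi_mat n * conj_mat U) @ [Pi_mat n *\<^sub>v conj_vec u])"
    and Q2k: "Q2k = mat_of_cols (2 * n) (cols U @ cols (Pi_mat n * conj_mat U))"
    and D: "D \<in> carrier_mat k k"
    and G_blocks: "G = diag_block_mat [D, scalar_mat \<delta>, - D, scalar_mat (- \<delta>)]"
    and G2k: "G2k = diag_block_mat [D, - D]"
    and \<zeta>: "\<zeta> = inv_mat R2k $$ (k - 1, k - 1)"
  shows "(invertible_mat R2k \<and> invertible_mat Rt \<and> invertible_mat (conj_mat Rt) \<and>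
     invertible_mat (Rt - conj_mat Rs * inv_mat (conj_mat Rt) * Rs) \<and>
     invertible_mat (conj_mat Rt - Rs * inv_mat Rt * conj_mat Rs) \<and>
     inv_mat R2k = four_block_mat
       (inv_mat (Rt - conj_mat Rs * inv_mat (conj_mat Rt) * Rs))
       (- (inv_mat (Rt - conj_mat Rs * inv_mat (conj_mat Rt) * Rs) * conj_mat Rs * inv_mat (conj_mat Rt)))
       (- (inv_mat (conj_mat Rt - Rs * inv_mat Rt * conj_mat Rs) * Rs * inv_mat Rt))
       (inv_mat (conj_mat Rt - Rs * inv_mat Rt * conj_mat Rs)) \<and>
     upper_triangular (inv_mat (Rt - conj_mat Rs * inv_mat (conj_mat Rt) * Rs)) \<and>
     strictly_upper_triangular
       (- (inv_mat (Rt - conj_mat Rs * inv_mat (conj_mat Rt) * Rs) * conj_mat Rs * inv_mat (conj_mat Rt)))) \<and>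
     Pi_Krylov n k H q1 = Q2k * R2k \<and>
     mat_adjoint Q2k * Gamma0 n * Q2k = G2k \<and>
     (\<exists>T11 T21.
       T11 \<in> carrier_mat k k \<and> unreduced_tridiagonal_mat T11 \<and>
       T21 \<in> carrier_mat k k \<and> diagonal_mat T21 \<and>
       H * Q2k = Q * four_block_mat
         (T11 @\<^sub>r mat_of_rows k [(\<zeta> * \<tau>) \<cdot>\<^sub>v unit_vec k (k - 1)])
         (- conj_mat T21 @\<^sub>r 0\<^sub>m 1 k)
         (T21 @\<^sub>r 0\<^sub>m 1 k)
         (- conj_mat T11 @\<^sub>r mat_of_rows k [(- (cnj \<zeta> * cnj \<tau>)) \<cdot>\<^sub>v unit_vec k (k - 1)]) \<and>
       mat_adjoint Q2k * Gamma0 n * H * Q2k =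
         G2k * four_block_mat T11 (- conj_mat T21) T21 (- conj_mat T11) \<and>
       mat_adjoint (D * T11) = D * T11) \<and>
     mat_adjoint Q2k * Gamma0 n *\<^sub>v u = 0\<^sub>v (2 * k) \<and>
     mat_adjoint Q2k * Gamma0 n *\<^sub>v (Pi_mat n *\<^sub>v conj_vec u) = 0\<^sub>v (2 * k)"

proof -
  define m where "m = k + 1"
  define P where "P = four_block_mat Rt (mat_of_cols k [rt]) (0\<^sub>m 1 k) (scalar_mat \<tau>)"
  define S where "S = four_block_mat Rs (mat_of_cols k [rs]) (0\<^sub>m 1 k) (0\<^sub>m 1 1)"
  let ?E = "shift_mat 0 m k" and ?F = "shift_mat 1 m k" and ?O = "0\<^sub>m m k"
  let ?EE = "Pi_block 1 ?E ?O" and ?FF = "Pi_block (- 1) ?F ?O"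
  let ?\<Gamma> = "Gamma0 n"
  have one: "(1::complex) = 1 \<or> (1::complex) = - 1" "(- 1::complex) = 1 \<or> (- 1::complex) = - 1"
    by simp_all

  have P: "P \<in> carrier_mat m m" "upper_band 0 P"
    unfolding P_def m_def upper_band_def using Rt by (auto simp: upper_triangular_def)
  have S: "S \<in> carrier_mat m m" "upper_band (- 1) S"
    unfolding S_def m_def upper_band_def using Rs by (auto simp: strictly_upper_triangular_def)
  have Rtb: "upper_band 0 Rt" and Rsb: "upper_band (- 1) Rs"
    using Rt Rs by (auto simp: upper_triangular_iff_band strictly_upper_triangular_iff_band)
  have R_block: "R = Pi_block 1 P S"
    unfolding R P_def S_def Pi_block_def
    by (simp, rule cong_four_block_mat; rule eq_matI)
      (use Rt Rs rt rs in \<open>auto simp: mat_of_cols_index\<close>)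
  have R2k_block: "R2k = Pi_block 1 Rt Rs" unfolding R2k Pi_block_def by simp

  have Qc: "Q \<in> carrier_mat (2 * n) (2 * m)" and QR': "K = Q * R"
    and GS: "G \<in> Gamma_set m"
    using QR unfolding is_Gamma_QR_def is_Pi_mat_def G m_def by auto
  \<comment> \<open>\<open>G\<close> is described twice, by its signature and by its given
    blocks; comparing entries shows that \<open>D\<close> is the leading part of the signature
    and hence real, diagonal and nonsingular.\<close>
  from GS obtain J' where J': "J' \<in> carrier_mat m m" "diagonal_mat J'"
    "\<forall>i<m. J' $$ (i, i) = 1 \<or> J' $$ (i, i) = - 1"
    and GJ': "G = four_block_mat J' (0\<^sub>m m m) (0\<^sub>m m m) (- J')"
    unfolding Gamma_set_def by blast
  have J'r: "conj_mat J' = J'"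
  proof (rule eq_matI)
    fix i j assume "i < dim_row J'" "j < dim_col J'"
    then show "conj_mat J' $$ (i, j) = J' $$ (i, j)"
      using J' by (cases "i = j") (auto simp: diagonal_mat_def)
  qed auto
  have GJ: "G = Pi_block (- 1) J' (0\<^sub>m m m)"
    unfolding GJ' Pi_block_def J'r by (rule cong_four_block_mat; rule eq_matI) (use J' in auto)
  have GD: "G $$ (i, j) = D $$ (i, j)" if "i < k" "j < k" for i j
    using that D unfolding G_blocks by (simp add: Let_def)
  have DJ: "D $$ (i, j) = J' $$ (i, j)" if "i < k" "j < k" for i j
    using GD[OF that] that J' unfolding GJ' m_def by simp
  have Dd: "diagonal_mat D" and D1: "\<forall>i<k. D $$ (i, i) = 1 \<or> D $$ (i, i) = - 1"
    using D DJ J' unfolding diagonal_mat_def m_def by auto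
  have Dr: "conj_mat D = D"
  proof (rule eq_matI)
    fix i j assume "i < dim_row D" "j < dim_col D"
    then show "conj_mat D $$ (i, j) = D $$ (i, j)"
      using D D1 Dd by (cases "i = j") (auto simp: diagonal_mat_def)
  qed auto
  have G2kD: "G2k = Pi_block (- 1) D (0\<^sub>m k k)"
    unfolding G2k Pi_block_def Dr by (rule eq_matI) (use D in \<open>auto simp: Let_def\<close>)

  have \<Gamma>c: "?\<Gamma> \<in> carrier_mat (2 * n) (2 * n)" by (auto simp: Gamma0_def mult_2)
  have Rc: "R \<in> carrier_mat (2 * m) (2 * m)" unfolding R_block using P S by simp
  have Ra: "mat_adjoint R \<in> carrier_mat (2 * m) (2 * m)" and Qa: "mat_adjoint Q \<in> carrier_mat (2 * m) (2 * n)"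
    using Rc Qc by simp_all
  have QaG: "mat_adjoint Q * ?\<Gamma> \<in> carrier_mat (2 * m) (2 * n)"
    using Qa \<Gamma>c by (rule mult_carrier_mat)
  have Gc: "G \<in> carrier_mat (2 * m) (2 * m)" unfolding GJ using J' by simp
  \<comment> \<open>The last leading minor makes \<open>R\<close> nonsingular, and triangularity
    passes this on to the leading part of \<open>R\<close>.\<close>
  have "mat_adjoint K * ?\<Gamma> * K = mat_adjoint R * G * R"
  proof -
    have "mat_adjoint K * ?\<Gamma> * K = (mat_adjoint R * mat_adjoint Q) * ?\<Gamma> * (Q * R)"
      unfolding QR' using mat_adjoint_mult[OF Qc Rc] by simp
    also have "(mat_adjoint R * mat_adjoint Q) * ?\<Gamma> = mat_adjoint R * (mat_adjoint Q * ?\<Gamma>)"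
      by (rule assoc_mult_mat[OF Ra Qa \<Gamma>c])
    also have "\<dots> * (Q * R) = mat_adjoint R * (mat_adjoint Q * ?\<Gamma> * (Q * R))"
      by (rule assoc_mult_mat[OF Ra QaG mult_carrier_mat[OF Qc Rc]])
    also have "mat_adjoint Q * ?\<Gamma> * (Q * R) = G * R"
      unfolding G by (rule assoc_mult_mat[symmetric, OF QaG Qc Rc])
    also have "mat_adjoint R * (G * R) = mat_adjoint R * G * R"
      by (rule assoc_mult_mat[symmetric, OF Ra Gc Rc])
    finally show ?thesis .
  qed
  moreover have "Pi_leading_minor (- 1) m (mat_adjoint K * ?\<Gamma> * K) m \<noteq> 0"
    using minors unfolding m_def by simp
  ultimately have detR: "det (Pi_block 1 P S) \<noteq> 0"
    using det_Pi_factor_nonzero[OF J'(1) P(1) S(1)] unfolding R_block GJ by simp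
  have Pd: "P $$ (i, i) \<noteq> 0" if "i < m" for i
    using Pi_upper_triangular_diag_nonzero[OF P S detR that] .
  have Rtd: "\<forall>i<k. Rt $$ (i, i) \<noteq> 0"
  proof (intro allI impI)
    fix i assume "i < k"
    then show "Rt $$ (i, i) \<noteq> 0" using Pd[of i] Rt unfolding P_def m_def by simp
  qed

  note inv = Pi_block_inverse[OF Rt(1) Rtb Rtd Rs(1) Rsb]
  define X where "X = inv_mat (Rt - conj_mat Rs * inv_mat (conj_mat Rt) * Rs)"
  define Y where "Y = - (inv_mat (conj_mat Rt - Rs * inv_mat Rt * conj_mat Rs) * Rs * inv_mat Rt)"
  have X: "X \<in> carrier_mat k k" "upper_band 0 X" and Xd: "\<forall>i<k. X $$ (i, i) \<noteq> 0"
    using inv(10,12,15) unfolding X_def by auto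
  have Y: "Y \<in> carrier_mat k k" "upper_band (- 1) Y"
    using inv(11,14) unfolding Y_def by auto
  let ?I = "Pi_block 1 X Y"
  have Ic: "?I \<in> carrier_mat (2 * k) (2 * k)" using X Y by simp
  have R2kc: "R2k \<in> carrier_mat (2 * k) (2 * k)" unfolding R2k_block using Rt Rs by simp
  have RI: "R2k * ?I = 1\<^sub>m (2 * k)"
    using inv(9) unfolding X_def Y_def R2k_block by simp
  have \<zeta>X: "\<zeta> = X $$ (k - 1, k - 1)"
    using inv(7) X Y k unfolding \<zeta> R2k_block X_def[symmetric] Y_def[symmetric]
    by (simp add: Pi_block_def)
  have part1: "invertible_mat R2k \<and> invertible_mat Rt \<and> invertible_mat (conj_mat Rt) \<and>
     invertible_mat (Rt - conj_mat Rs * inv_mat (conj_mat Rt) * Rs) \<and>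
     invertible_mat (conj_mat Rt - Rs * inv_mat Rt * conj_mat Rs) \<and>
     inv_mat R2k = four_block_mat
       (inv_mat (Rt - conj_mat Rs * inv_mat (conj_mat Rt) * Rs))
       (- (inv_mat (Rt - conj_mat Rs * inv_mat (conj_mat Rt) * Rs) * conj_mat Rs * inv_mat (conj_mat Rt)))
       (- (inv_mat (conj_mat Rt - Rs * inv_mat Rt * conj_mat Rs) * Rs * inv_mat Rt))
       (inv_mat (conj_mat Rt - Rs * inv_mat Rt * conj_mat Rs)) \<and>
     upper_triangular (inv_mat (Rt - conj_mat Rs * inv_mat (conj_mat Rt) * Rs)) \<and>
     strictly_upper_triangular
       (- (inv_mat (Rt - conj_mat Rs * inv_mat (conj_mat Rt) * Rs) * conj_mat Rs * inv_mat (conj_mat Rt)))"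
    using inv(1-6,12,13) upper_triangular_iff_band[OF inv(10)]
    unfolding R2k_block strictly_upper_triangular_iff_band by blast

  have Ec: "?E \<in> carrier_mat m k" and EEc: "?EE \<in> carrier_mat (2 * m) (2 * k)"
    and FFc: "?FF \<in> carrier_mat (2 * m) (2 * k)" by simp_all
  have Kc: "K \<in> carrier_mat (2 * n) (2 * m)" unfolding K m_def by (rule Pi_Krylov_carrier)
  have PiUc: "Pi_mat n * conj_mat U \<in> carrier_mat (2 * n) k"
    using U by (auto intro!: mult_carrier_mat[OF Pi_mat_carrier])
  have Q2kc: "Q2k \<in> carrier_mat (2 * n) (2 * k)"
    unfolding Q2k using U PiUc by (intro carrier_matI) auto
  have Q_index: "Q $$ (i, j) = (if j < k then U $$ (i, j) else if j = k then u $ i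
      else if j < 2 * k + 1 then (Pi_mat n * conj_mat U) $$ (i, j - (k + 1))
      else (Pi_mat n *\<^sub>v conj_vec u) $ i)" if "i < 2 * n" "j < 2 * m" for i j
    using that U PiUc unfolding Q m_def
    by (subst mat_of_cols_index) (auto simp: nth_append nth_Cons' cols_def simp del: index_mult_mat index_mult_mat_vec)
  have Q2kE: "Q2k = Q * ?EE"
  proof (rule eq_matI)
    fix i j assume "i < dim_row (Q * ?EE)" "j < dim_col (Q * ?EE)"
    then have ij: "i < 2 * n" "j < 2 * k" using Qc carrier_matD[OF EEc] by auto
    have "Q2k $$ (i, j) = (if j < k then U $$ (i, j) else (Pi_mat n * conj_mat U) $$ (i, j - k))"
      using ij U PiUc unfolding Q2k
      by (subst mat_of_cols_index) (auto simp: nth_append cols_def simp del: index_mult_mat)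
    moreover have "(Q * ?EE) $$ (i, j) = (if j < k then Q $$ (i, j + 0) else 1 * Q $$ (i, m + (j - k) + 0))"
      by (rule mult_Pi_shift_index[OF Qc ij]) (simp add: m_def)
    ultimately show "Q2k $$ (i, j) = (Q * ?EE) $$ (i, j)"
      using ij by (auto simp: Q_index m_def)
  qed (use Q2kc Qc carrier_matD[OF EEc] in auto)

  \<comment> \<open>Triangularity of \<open>R\<close>: the span of the leading columns stays
    within the leading rows.\<close>
  have REE: "R * ?EE = ?EE * R2k"
  proof -
    have PE: "P * ?E = ?E * Rt"
    proof (rule eq_matI)
      fix i j assume "i < dim_row (?E * Rt)" "j < dim_col (?E * Rt)"
      then have "i < m" "j < k" using Rt by auto
      then show "(P * ?E) $$ (i, j) = (?E * Rt) $$ (i, j)"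
        using mult_shift_index[OF P(1), of i j k 0] shift_mult_index[OF Rt(1), of i m j] Rt
        by (auto simp: m_def P_def)
    qed (use P Rt in auto)
    have SE: "S * ?E = ?E * Rs"
    proof (rule eq_matI)
      fix i j assume "i < dim_row (?E * Rs)" "j < dim_col (?E * Rs)"
      then have "i < m" "j < k" using Rs by auto
      then show "(S * ?E) $$ (i, j) = (?E * Rs) $$ (i, j)"
        using mult_shift_index[OF S(1), of i j k 0] shift_mult_index[OF Rs(1), of i m j] Rs
        by (auto simp: m_def S_def)
    qed (use S Rs in auto)
    show ?thesis
      unfolding R_block R2k_block Pi_block_mult_real[OF P(1) S(1) Ec one(1,1)]
        Pi_block_real_mult[OF Ec Rt(1) Rs(1) conj_shift_mat one(1,1)] PE SE by simp
  qed
  have KkEE: "Pi_Krylov n k H q1 = K * ?EE"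
    unfolding K m_def by (rule Pi_Krylov_select) simp
  have part2: "Pi_Krylov n k H q1 = Q2k * R2k"
  proof -
    have "K * ?EE = Q * (R * ?EE)" unfolding QR' by (rule assoc_mult_mat[OF Qc Rc EEc])
    also have "\<dots> = Q2k * R2k" unfolding REE Q2kE
      by (rule assoc_mult_mat[symmetric, OF Qc EEc R2kc])
    finally show ?thesis using KkEE by simp
  qed

  have Hc: "H \<in> carrier_mat (2 * n) (2 * n)" unfolding H using A B by (auto simp: mult_2)
  obtain W V where W: "W \<in> carrier_mat m k" "upper_band 1 W" and V: "V \<in> carrier_mat m k" "upper_band 0 V"
    and Wsub: "\<And>j. j < k \<Longrightarrow> W $$ (j + 1, j) = P $$ (j + 1, j + 1) * X $$ (j, j)"
    and WV: "R * ?FF * ?I = Pi_block (- 1) W V"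
    using Hessenberg_product[OF P[unfolded m_def] S[unfolded m_def] X Y] unfolding R_block m_def
    by metis
  let ?T = "Pi_block (- 1) W V"
  have Tc: "?T \<in> carrier_mat (2 * m) (2 * k)" using W V by simp
  \<comment> \<open>Going through the Krylov matrix, where \<open>H\<close> acts as a shift,
    turns the action of \<open>H\<close> on \<open>Q2k\<close> into a matrix of coordinates with
    respect to \<open>Q\<close>.\<close>
  have HQ: "H * Q2k = Q * ?T"
  proof -
    have RF: "R * ?FF \<in> carrier_mat (2 * m) (2 * k)" using Rc FFc by (rule mult_carrier_mat)
    have "H * Q2k = H * (Q2k * (R2k * ?I))" using RI Q2kc by simp
    also have "Q2k * (R2k * ?I) = Pi_Krylov n k H q1 * ?I"
      unfolding part2 by (rule assoc_mult_mat[symmetric, OF Q2kc R2kc Ic])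
    also have "H * \<dots> = H * Pi_Krylov n k H q1 * ?I"
      by (rule assoc_mult_mat[symmetric, OF Hc Pi_Krylov_carrier Ic])
    also have "H * Pi_Krylov n k H q1 = K * ?FF"
      unfolding K m_def by (rule Hamiltonian_Krylov[OF A(1) B(1) H q1]) simp
    also have "K * ?FF = Q * (R * ?FF)" unfolding QR' by (rule assoc_mult_mat[OF Qc Rc FFc])
    also have "Q * (R * ?FF) * ?I = Q * (R * ?FF * ?I)" by (rule assoc_mult_mat[OF Qc RF Ic])
    finally show ?thesis unfolding WV .
  qed

  let ?Et = "transpose_mat ?E"
  define N where "N = mat_adjoint Q2k * ?\<Gamma>"
  have Nc: "N \<in> carrier_mat (2 * k) (2 * n)"
    unfolding N_def using Q2kc \<Gamma>c by (intro mult_carrier_mat[where n = "2 * n"]) simp_all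
  have EEt: "mat_adjoint ?EE = Pi_block 1 ?Et (0\<^sub>m k m)"
    by (subst Pi_block_adjoint[OF Ec _ one(1)]) (auto simp: mat_adjoint_eq)
  have Etc: "?Et \<in> carrier_mat k m" by simp
  have EEtc: "mat_adjoint ?EE \<in> carrier_mat (2 * k) (2 * m)" using EEc by simp
  have Etr: "conj_mat ?Et = ?Et" by (rule eq_matI) (auto simp: shift_mat_def)
  have G2kc: "G2k \<in> carrier_mat (2 * k) (2 * k)" unfolding G2kD using D by simp
  have EJ: "?Et * J' = D * ?Et"
  proof (rule eq_matI)
    fix i j assume "i < dim_row (D * ?Et)" "j < dim_col (D * ?Et)"
    then have ij: "i < k" "j < m" using D by auto
    have "(?Et * J') $$ (i, j) = J' $$ (i + 0, j)"
      by (rule shift_transpose_mult_index[OF J'(1) ij]) (use ij in \<open>simp add: m_def\<close>)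
    moreover have "(D * ?Et) $$ (i, j) = D $$ (i, i) * ?Et $$ (i, j)"
      by (rule diagonal_mult_index[OF D Dd Etc ij])
    ultimately show "(?Et * J') $$ (i, j) = (D * ?Et) $$ (i, j)"
      using ij J' DJ[of i i] by (auto simp: shift_mat_def diagonal_mat_def m_def)
  qed (use J' D in auto)
  \<comment> \<open>\<open>N\<close> computes \<open>\<Gamma>\<close>-inner products with the
    columns of \<open>Q2k\<close>; on the columns of \<open>Q\<close> these are the leading rows of
    \<open>G\<close>, which factor through \<open>G2k\<close> because \<open>G\<close> is diagonal.\<close>
  have NQ: "N * Q = G2k * mat_adjoint ?EE"
  proof -
    have "N = mat_adjoint ?EE * (mat_adjoint Q * ?\<Gamma>)"
      unfolding N_def Q2kE mat_adjoint_mult[OF Qc EEc]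
      by (rule assoc_mult_mat[OF EEtc _ \<Gamma>c]) (use Qc in simp)
    then have "N * Q = mat_adjoint ?EE * G"
      unfolding G using assoc_mult_mat[OF EEtc QaG Qc] by simp
    also have "\<dots> = G2k * mat_adjoint ?EE"
      unfolding EEt GJ G2kD
      by (subst (1 2) Pi_block_mult_real[OF _ _ _ _ _]) 
        (use J' D EJ in auto)
    finally show ?thesis .
  qed
  have EtE: "mat_adjoint ?EE * ?EE = 1\<^sub>m (2 * k)"
    unfolding EEt Pi_block_mult_real[OF Etc zero_carrier_mat Ec one(1,1)]
    using shift_transpose_shift[of k m] by (simp add: m_def Pi_block_one)
  have part3: "N * Q2k = G2k"
  proof -
    have "N * Q2k = N * Q * ?EE" unfolding Q2kE by (rule assoc_mult_mat[symmetric, OF Nc Qc EEc])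
    also have "\<dots> = G2k * (mat_adjoint ?EE * ?EE)" unfolding NQ
      by (rule assoc_mult_mat[OF G2kc EEtc EEc])
    finally show ?thesis unfolding EtE using G2kc by simp
  qed

  define T11 where "T11 = ?Et * W"
  define T21 where "T21 = ?Et * V"
  have T11: "T11 \<in> carrier_mat k k" and T21: "T21 \<in> carrier_mat k k"
    unfolding T11_def T21_def using W V by auto
  have T11W: "T11 $$ (i, j) = W $$ (i, j)" if "i < k" "j < k" for i j
    unfolding T11_def using shift_transpose_mult_index[OF W(1), of i k j 0] that by (simp add: m_def)
  have T21V: "T21 $$ (i, j) = V $$ (i, j)" if "i < k" "j < k" for i j
    unfolding T21_def using shift_transpose_mult_index[OF V(1), of i k j 0] that by (simp add: m_def)
  let ?T2 = "Pi_block (- 1) T11 T21"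
  have T2: "four_block_mat T11 (- conj_mat T21) T21 (- conj_mat T11) = ?T2"
    unfolding Pi_block_def by (rule cong_four_block_mat) (auto intro!: eq_matI)
  have part4b: "N * H * Q2k = G2k * ?T2"
  proof -
    have "N * H * Q2k = N * (Q * ?T)" unfolding HQ[symmetric] by (rule assoc_mult_mat[OF Nc Hc Q2kc])
    also have "\<dots> = N * Q * ?T" by (rule assoc_mult_mat[symmetric, OF Nc Qc Tc])
    also have "\<dots> = G2k * (mat_adjoint ?EE * ?T)" unfolding NQ
      by (rule assoc_mult_mat[OF G2kc EEtc Tc])
    also have "mat_adjoint ?EE * ?T = ?T2"
      unfolding EEt Pi_block_real_mult[OF Etc W(1) V(1) Etr one(1,2)] T11_def T21_def by simp
    finally show ?thesis .
  qed
  \<comment> \<open>Row \<open>k\<close> of a Hessenberg matrix with \<open>k\<close> columns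
    has a single, subdiagonal, entry.\<close>
  have Wlast: "W $$ (k, j) = ((\<zeta> * \<tau>) \<cdot>\<^sub>v unit_vec k (k - 1)) $ j" if "j < k" for j
  proof (cases "j = k - 1")
    case True
    have "P $$ (k, k) = \<tau>" unfolding P_def using Rt by simp
    then show ?thesis using Wsub[OF that] True k that \<zeta>X by simp
  next
    case False
    then show ?thesis using upper_bandD[OF W(2,1), of k j] that by (simp add: m_def)
  qed
  have Vlast: "V $$ (k, j) = 0" if "j < k" for j
    using upper_bandD[OF V(2,1), of k j] that by (simp add: m_def)
  have part4a: "?T = four_block_mat
      (T11 @\<^sub>r mat_of_rows k [(\<zeta> * \<tau>) \<cdot>\<^sub>v unit_vec k (k - 1)])
      (- conj_mat T21 @\<^sub>r 0\<^sub>m 1 k)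
      (T21 @\<^sub>r 0\<^sub>m 1 k)
      (- conj_mat T11 @\<^sub>r mat_of_rows k [(- (cnj \<zeta> * cnj \<tau>)) \<cdot>\<^sub>v unit_vec k (k - 1)])"
    unfolding Pi_block_def
  proof (rule cong_four_block_mat)
    have row: "mat_of_rows k [v] \<in> carrier_mat 1 k" "j < k \<Longrightarrow> mat_of_rows k [v] $$ (0, j) = v $ j"
      for v :: "complex vec" and j
      by (auto simp: mat_of_rows_index carrier_matI)
    show "W = T11 @\<^sub>r mat_of_rows k [(\<zeta> * \<tau>) \<cdot>\<^sub>v unit_vec k (k - 1)]"
      by (rule append_rows_eqI[OF W(1)[unfolded m_def] T11 row(1)]) (simp_all add: T11W Wlast row)
    show "V = T21 @\<^sub>r 0\<^sub>m 1 k"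
      by (rule append_rows_eqI[OF V(1)[unfolded m_def] T21]) (simp_all add: T21V Vlast)
    show "- 1 \<cdot>\<^sub>m conj_mat V = - conj_mat T21 @\<^sub>r 0\<^sub>m 1 k"
    proof (rule append_rows_eqI[of _ k k])
      fix i j :: nat assume ij: "i < k" "j < k"
      show "(- 1 \<cdot>\<^sub>m conj_mat V) $$ (i, j) = (- conj_mat T21) $$ (i, j)"
        using V(1) T21 T21V[OF ij] ij by (simp add: m_def)
    next
      fix j assume "j < k"
      then show "(- 1 \<cdot>\<^sub>m conj_mat V) $$ (k, j) = 0\<^sub>m 1 k $$ (0, j)"
        using V(1) Vlast by (simp add: m_def)
    qed (use V(1) T21 in \<open>simp_all add: m_def\<close>)
    show "- 1 \<cdot>\<^sub>m conj_mat W =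
        - conj_mat T11 @\<^sub>r mat_of_rows k [(- (cnj \<zeta> * cnj \<tau>)) \<cdot>\<^sub>v unit_vec k (k - 1)]"
    proof (rule append_rows_eqI[of _ k k])
      fix i j :: nat assume ij: "i < k" "j < k"
      show "(- 1 \<cdot>\<^sub>m conj_mat W) $$ (i, j) = (- conj_mat T11) $$ (i, j)"
        using W(1) T11 T11W[OF ij] ij by (simp add: m_def)
    next
      fix j assume j: "j < k"
      then show "(- 1 \<cdot>\<^sub>m conj_mat W) $$ (k, j) =
          mat_of_rows k [(- (cnj \<zeta> * cnj \<tau>)) \<cdot>\<^sub>v unit_vec k (k - 1)] $$ (0, j)"
        using W(1) Wlast[OF j] k row(2)[OF j] by (simp add: m_def unit_vec_def)
    qed (use W(1) T11 row(1) in \<open>simp_all add: m_def\<close>)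
  qed

  \<comment> \<open>Symmetry in the other direction: the compression of the Hermitian matrix
    \<open>\<Gamma> H\<close> is Hermitian.\<close>
  have herm: "mat_adjoint (G2k * ?T2) = G2k * ?T2"
  proof -
    have \<Gamma>H: "?\<Gamma> * H \<in> carrier_mat (2 * n) (2 * n)" using \<Gamma>c Hc by (rule mult_carrier_mat)
    have Qka: "mat_adjoint Q2k \<in> carrier_mat (2 * k) (2 * n)" using Q2kc by simp
    have \<Gamma>HQ: "?\<Gamma> * H * Q2k \<in> carrier_mat (2 * n) (2 * k)" using \<Gamma>H Q2kc by (rule mult_carrier_mat)
    have e: "N * H * Q2k = mat_adjoint Q2k * (?\<Gamma> * H * Q2k)"
      unfolding N_def assoc_mult_mat[OF Qka \<Gamma>c Hc] by (rule assoc_mult_mat[OF Qka \<Gamma>H Q2kc])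
    have "mat_adjoint (N * H * Q2k) = mat_adjoint Q2k * (?\<Gamma> * H) * Q2k"
      unfolding e mat_adjoint_mult[OF Qka \<Gamma>HQ] mat_adjoint_mult[OF \<Gamma>H Q2kc]
        Gamma0_Hamiltonian_Hermitian[OF A B H] by simp
    also have "\<dots> = N * H * Q2k" unfolding e by (rule assoc_mult_mat[OF Qka \<Gamma>H Q2kc])
    finally show ?thesis unfolding part4b .
  qed
  have DT11: "D * T11 \<in> carrier_mat k k" and DT21: "D * T21 \<in> carrier_mat k k" using D T11 T21 by auto
  have GT: "G2k * ?T2 = Pi_block 1 (D * T11) (- 1 \<cdot>\<^sub>m (D * T21))"
    unfolding G2kD Pi_block_real_mult[OF D T11 T21 Dr one(2,2)] by simp
  have blocks: "mat_adjoint (D * T11) = D * T11" "1 \<cdot>\<^sub>m transpose_mat (- 1 \<cdot>\<^sub>m (D * T21)) = - 1 \<cdot>\<^sub>m (D * T21)"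
  proof -
    have "Pi_block 1 (mat_adjoint (D * T11)) (1 \<cdot>\<^sub>m transpose_mat (- 1 \<cdot>\<^sub>m (D * T21))) =
        Pi_block 1 (D * T11) (- 1 \<cdot>\<^sub>m (D * T21))"
      using herm unfolding GT by (subst (asm) Pi_block_adjoint[OF DT11 _ one(1)]) (use DT21 in auto)
    from Pi_block_inject[OF this, of k k] DT11 DT21
    show "mat_adjoint (D * T11) = D * T11" "1 \<cdot>\<^sub>m transpose_mat (- 1 \<cdot>\<^sub>m (D * T21)) = - 1 \<cdot>\<^sub>m (D * T21)"
      by auto
  qed
  have Dnz: "\<forall>i<k. D $$ (i, i) \<noteq> 0" using D1 by force
  have bT11: "upper_band 1 T11" and bT21: "upper_band 0 T21"
    using W V T11 T21 T11W T21V by (auto simp: upper_band_def m_def)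
  have unred: "unreduced_tridiagonal_mat T11"
    unfolding unreduced_tridiagonal_mat_def
  proof (intro conjI allI impI)
    show "tridiagonal_mat T11"
      by (rule Hermitian_Hessenberg_tridiagonal[OF D Dd Dnz T11 bT11 blocks(1)])
  next
    fix i assume "i + 1 < dim_row T11"
    then have i: "i + 1 < k" using T11 by simp
    then have "T11 $$ (i + 1, i) = P $$ (i + 1, i + 1) * X $$ (i, i)"
      using T11W[of "i + 1" i] Wsub[of i] by simp
    then show "T11 $$ (i + 1, i) \<noteq> 0" using Pd[of "i + 1"] Xd i by (simp add: m_def)
  qed
  have diag: "diagonal_mat T21"
  proof (rule symmetric_upper_triangular_diagonal[OF D Dd Dnz T21 bT21])
    show "transpose_mat (D * T21) = D * T21"
    proof (rule eq_matI)
      fix i j assume "i < dim_row (D * T21)" "j < dim_col (D * T21)"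
      moreover have "(1 \<cdot>\<^sub>m transpose_mat (- 1 \<cdot>\<^sub>m (D * T21))) $$ (i, j) =
          (- 1 \<cdot>\<^sub>m (D * T21)) $$ (i, j)"
        unfolding blocks(2) ..
      ultimately show "transpose_mat (D * T21) $$ (i, j) = (D * T21) $$ (i, j)"
        using carrier_matD[OF DT21] by (simp del: index_mult_mat(1))
    qed (use carrier_matD[OF DT21] in simp_all)
  qed

  \<comment> \<open>The remaining two columns of \<open>Q\<close> are
    \<open>\<Gamma>\<close>-orthogonal to those of \<open>Q2k\<close>, because the adjoint of
    the selection in \<open>NQ\<close> annihilates the coordinate vectors \<open>k\<close> and \<open>m + k\<close>.\<close>
  have NQ_zero: "N *\<^sub>v col Q j = 0\<^sub>v (2 * k)" if j: "j = k \<or> j = m + k" for j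
  proof (rule eq_vecI)
    fix i assume "i < dim_vec (0\<^sub>v (2 * k) :: complex vec)"
    then have i: "i < 2 * k" by simp
    have jm: "j < 2 * m" using j by (auto simp: m_def)
    have "(N *\<^sub>v col Q j) $ i = (N * Q) $$ (i, j)" using i jm Nc Qc by simp
    also have "N * Q = Pi_block (- 1) (D * ?Et) (0\<^sub>m k k * ?Et)"
      unfolding NQ EEt G2kD by (subst Pi_block_mult_real[OF D _ Etc one(2,1)]) simp_all
    also have "\<dots> $$ (i, j) = 0"
    proof -
      have z: "(D * ?Et) $$ (a, k) = 0" if "a < k" for a
        using diagonal_mult_index[OF D Dd Etc that, of k] that by (simp add: m_def shift_mat_def)
      have c: "D * ?Et \<in> carrier_mat k m" using D Etc by (rule mult_carrier_mat)
      have O: "0\<^sub>m k k * ?Et = 0\<^sub>m k m" by (rule left_mult_zero_mat[OF Etc])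
      show ?thesis
        unfolding O Pi_block_def using i j c z[of i] z[of "i - k"] carrier_matD[OF c]
        by (auto simp: m_def simp del: index_mult_mat(1))
    qed
    finally show "(N *\<^sub>v col Q j) $ i = 0\<^sub>v (2 * k) $ i" using i by simp
  qed (use Nc in simp)
  have "u = col Q k"
    by (rule eq_vecI) (use u Qc Q_index[of _ k] in \<open>auto simp: m_def\<close>)
  then have part6a: "N *\<^sub>v u = 0\<^sub>v (2 * k)" using NQ_zero[of k] by simp
  have "Pi_mat n *\<^sub>v conj_vec u = col Q (m + k)"
    by (rule eq_vecI) (use carrier_matD[OF Pi_mat_carrier, of n] Qc Q_index[of _ "m + k"] in
      \<open>auto simp: m_def simp del: index_mult_mat_vec\<close>)
  then have part6b: "N *\<^sub>v (Pi_mat n *\<^sub>v conj_vec u) = 0\<^sub>v (2 * k)" using NQ_zero[of "m + k"] by simp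
  show ?thesis
    using part1 part2 part3 HQ[unfolded part4a] part4b[folded T2] part6a part6b T11 T21 unred diag blocks(1)
    unfolding N_def by blast
qed

end
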